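(* Let $M$ be a hypercomplex subspace of $A$ and let $\Omega=\Omega_D\cap M$ be an axially symmetric open subset of $M$ which is a star-like domain with centre $0$. Let $f:\Omega\to A$ be slice-regular. If $A$ is not associative, assume that $f$ and $xf$ are $M$-admissible. Let $m=\dim(M)-1\ge3$ be odd. Then there exist $A$-valued slice functions $f_0,\dots,f_{(m-3)/2}$ on $\Omega$ in the kernel of the operator $\overline\partial_{\mathcal B}\Delta_{\mathcal B}$ such that $$f(x)=f_0(x)+\|x\|^2f_1(x)+\cdots+\|x\|^{m-3}f_{\frac{m-3}2}(x)\qquad\forall x\in\Omega.$$ In particular, the functions $f_0,\dots,f_{(m-3)/2}$ are biharmonic. The function $f$ is slice-preserving if and only if $f_0,\dots,f_{(m-3)/2}$ are slice-preserving.
   Context: $A$ is a finite-dimensional real alternative algebra with unity $1\ne0$ (the associator $(x,y,z)=(xy)z-x(yz)$ is alternating), $\mathbb R$ is identified with $\mathbb R\cdot 1$, and $A$ is a *-algebra with real linear anti-involution $x\mapsto x^c$, $(xy)^c=y^cx^c$, $x^c=x$ for $x\in\mathbb R$. Put $t(x)=x+x^c$, $n(x)=xx^c$, $\mathbb S_A=\{J\in A: t(J)=0,\ n(J)=1\}\neq\emptyset$, $\mathbb C_J=\mathrm{span}(1,J)$, $Q_A=\bigcup_{J\in\mathbb S_A}\mathbb C_J$. A hypercomplex subspace is a real vector subspace $M$ of $A$ with $\mathbb R\subset M\subset Q_A$ and $\dim(M)>2$. On $M$, $\langle x,y\rangle=\frac12t(xy^c)$ is a scalar product with norm $\|x\|=n(x)^{1/2}$.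 $\mathcal B=(v_0=1,v_1,\dots,v_m)$ is an orthonormal basis of $M$, $x=\sum_{i=0}^mx_iv_i$, $\partial_i$ is the partial derivative w.r.t. $x_i$ of $A$-valued functions (componentwise), $\overline\partial_{\mathcal B}=\frac12(\partial_0+\sum_{i=1}^mv_i\partial_i)$, $\Delta_{\mathcal B}=\sum_{i=0}^m\partial_i^2$; biharmonic means in the kernel of $\Delta_{\mathcal B}^2$. A $\mathcal C^1$ function $f:\Omega\to A$ is $M$-admissible if $f(x),\overline\partial_{\mathcal B}f(x)\in M$ for all $x\in\Omega$. $xf$ is the pointwise product $x\mapsto xf(x)$. Slice functions: let $D\subseteq\mathbb C$ be open and conjugation-invariant, $\Omega_D=\{\alpha+J\beta:\alpha+i\beta\in D,\ J\in\mathbb S_A\}$. A stem function is $F=F_1+\imath F_2:D\to A\otimes_{\mathbb R}\mathbb C$ ($\imath^2=-1$) with $F(\overline z)=\overline{F(z)}$, where $\overline{a+\imath b}=a-\imath b$; it induces the slice function $\mathcal I(F):\Omega_D\to A$, $\alpha+J\beta\mapsto F_1(\alpha+i\beta)+JF_2(\alpha+i\beta)$. It is slice-regular if $F$ is holomorphic w.r.t. left multiplication by $\imath$, and slice-preserving if $F_1,F_2$ are real-valued. Slice (slice-regular, slice-preserving) functions on $\Omega=\Omega_D\cap M$ are restrictions of such functions on $\Omega_D$. *)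

theory Defs
  imports "HOL-Analysis.Analysis"
begin

class minus_times = minus + times
begin

definition associator :: "'a \<Rightarrow> 'a \<Rightarrow> 'a \<Rightarrow> 'a" where
  "associator x y z = (x * y) * z - x * (y * z)"

end

text \<open>
  The algebra is modelled on a type of class \<open>euclidean_space\<close> so that finite dimension and
  the canonical vector space topology are available. The inner product and norm of that class are
  auxiliary and unrelated to the multiplication. The embedding of the reals is
  \<open>r \<mapsto> r *\<^sub>R 1\<close>.
\<close>

class alternative_star_algebra = euclidean_space + minus_times + one +
  fixes star :: "'a \<Rightarrow> 'a"
  assumes mult_add_left: "(x + y) * z = x * z + y * z"
    and mult_add_right: "x * (y + z) = x * y + x * z"
    and mult_scaleR_left: "(r *\<^sub>R x) * y = r *\<^sub>R (x * y)"
    and mult_scaleR_right: "x * (r *\<^sub>R y) = r *\<^sub>R (x * y)"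
    and mult_one_left: "1 * x = x"
    and mult_one_right: "x * 1 = x"
    and one_neq_zero: "1 \<noteq> 0"
    and associator_left: "associator x x y = 0"
    and associator_right: "associator x y y = 0"
    and associator_flexible: "associator x y x = 0"
    and star_add: "star (x + y) = star x + star y"
    and star_scaleR: "star (r *\<^sub>R x) = r *\<^sub>R star x"
    and star_involution: "star (star x) = x"
    and star_mult: "star (x * y) = star y * star x"
    and star_real: "star (r *\<^sub>R 1) = r *\<^sub>R 1"

definition alg_trace :: "'a::alternative_star_algebra \<Rightarrow> 'a" where
  "alg_trace x = x + star x"

definition alg_norm :: "'a::alternative_star_algebra \<Rightarrow> 'a" where
  "alg_norm x = x * star x"

definition imag_units :: "'a::alternative_star_algebra set" where
  "imag_units = {J. alg_trace J = 0 \<and> alg_norm J = 1}"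

definition quadratic_cone :: "'a::alternative_star_algebra set" where
  "quadratic_cone = (\<Union>J\<in>imag_units. span {1, J})"

definition hypercomplex_subspace :: "'a::alternative_star_algebra set \<Rightarrow> bool" where
  "hypercomplex_subspace M \<longleftrightarrow>
     subspace M \<and> span {1} \<subseteq> M \<and> M \<subseteq> quadratic_cone \<and> dim M > 2"

text \<open>
  Inverse of the embedding of the reals; only meaningful on \<open>span {1}\<close>. For \<open>x\<close> and
  \<open>y\<close> in a hypercomplex subspace, both arguments it is applied to below lie there.
\<close>

definition real_value :: "'a::alternative_star_algebra \<Rightarrow> real" where
  "real_value x = (THE r. x = r *\<^sub>R 1)"

definition hc_inner :: "'a::alternative_star_algebra \<Rightarrow> 'a \<Rightarrow> real" where
  "hc_inner x y = real_value ((1/2) *\<^sub>R alg_trace (x * star y))"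

definition hc_norm :: "'a::alternative_star_algebra \<Rightarrow> real" where
  "hc_norm x = sqrt (real_value (alg_norm x))"

definition orthonormal_basis ::
    "'a::alternative_star_algebra set \<Rightarrow> nat \<Rightarrow> (nat \<Rightarrow> 'a) \<Rightarrow> bool" where
  "orthonormal_basis M m v \<longleftrightarrow>
     v 0 = 1 \<and> (\<forall>i\<le>m. v i \<in> M) \<and> span (v ` {..m}) = M \<and>
     (\<forall>i\<le>m. \<forall>j\<le>m. hc_inner (v i) (v j) = (if i = j then 1 else 0))"

text \<open>
  Functions on a relatively open subset \<open>W\<close> of \<open>M = span (v ` {..m})\<close> are total functions
  of which only the values on \<open>W\<close> matter: since all \<open>v i\<close> lie in \<open>M\<close>, the
  partial derivatives at points of \<open>W\<close> only see values on \<open>W\<close>.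
\<close>

definition partial :: "(nat \<Rightarrow> 'a) \<Rightarrow> nat \<Rightarrow> ('a \<Rightarrow> 'a) \<Rightarrow> 'a \<Rightarrow> 'a::alternative_star_algebra" where
  "partial v i f x = vector_derivative (\<lambda>t. f (x + t *\<^sub>R v i)) (at 0)"

primrec Ck_on :: "nat \<Rightarrow> nat \<Rightarrow> (nat \<Rightarrow> 'a) \<Rightarrow> 'a set \<Rightarrow> ('a \<Rightarrow> 'a::alternative_star_algebra) \<Rightarrow> bool" where
  "Ck_on 0 m v W f \<longleftrightarrow> continuous_on W f"
| "Ck_on (Suc k) m v W f \<longleftrightarrow>
     (\<forall>i\<le>m. (\<forall>x\<in>W. (\<lambda>t. f (x + t *\<^sub>R v i)) differentiable (at (0::real))) \<and>
            Ck_on k m v W (partial v i f))"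

definition dbar :: "nat \<Rightarrow> (nat \<Rightarrow> 'a) \<Rightarrow> ('a \<Rightarrow> 'a) \<Rightarrow> 'a \<Rightarrow> 'a::alternative_star_algebra" where
  "dbar m v f x = (1/2) *\<^sub>R (partial v 0 f x + (\<Sum>i=1..m. v i * partial v i f x))"

definition laplace :: "nat \<Rightarrow> (nat \<Rightarrow> 'a) \<Rightarrow> ('a \<Rightarrow> 'a) \<Rightarrow> 'a \<Rightarrow> 'a::alternative_star_algebra" where
  "laplace m v f x = (\<Sum>i=0..m. partial v i (partial v i f) x)"

text \<open>
  The derivative operators above are total, so membership in a kernel has to include the
  differentiability which makes the operator applicable: the order of the operator.
\<close>

definition in_kernel_dbar_laplace ::
    "nat \<Rightarrow> (nat \<Rightarrow> 'a) \<Rightarrow> 'a set \<Rightarrow> ('a \<Rightarrow> 'a::alternative_star_algebra) \<Rightarrow> bool" where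
  "in_kernel_dbar_laplace m v W f \<longleftrightarrow>
     Ck_on 3 m v W f \<and> (\<forall>x\<in>W. dbar m v (laplace m v f) x = 0)"

definition biharmonic_on ::
    "nat \<Rightarrow> (nat \<Rightarrow> 'a) \<Rightarrow> 'a set \<Rightarrow> ('a \<Rightarrow> 'a::alternative_star_algebra) \<Rightarrow> bool" where
  "biharmonic_on m v W f \<longleftrightarrow>
     Ck_on 4 m v W f \<and> (\<forall>x\<in>W. laplace m v (laplace m v f) x = 0)"

definition admissible ::
    "'a set \<Rightarrow> nat \<Rightarrow> (nat \<Rightarrow> 'a) \<Rightarrow> 'a set \<Rightarrow> ('a \<Rightarrow> 'a::alternative_star_algebra) \<Rightarrow> bool" where
  "admissible M m v W f \<longleftrightarrow>
     Ck_on 1 m v W f \<and> (\<forall>x\<in>W. f x \<in> M \<and> dbar m v f x \<in> M)"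

definition circularization :: "complex set \<Rightarrow> 'a::alternative_star_algebra set" where
  "circularization D = {Re z *\<^sub>R 1 + Im z *\<^sub>R J | z J. z \<in> D \<and> J \<in> imag_units}"

text \<open>
  The complexification of the algebra is encoded by pairs, \<open>(a, b)\<close> standing for
  \<open>a + \<iota> b\<close>: conjugation is \<open>(a, - b)\<close> and multiplication by \<open>\<iota>\<close> gives
  \<open>(- b, a)\<close>. Holomorphy means that the real derivative commutes with the two complex
  structures.
\<close>

definition stem_function :: "complex set \<Rightarrow> (complex \<Rightarrow> 'a \<times> 'a::alternative_star_algebra) \<Rightarrow> bool" where
  "stem_function D F \<longleftrightarrow> (\<forall>z\<in>D. F (cnj z) = (fst (F z), - snd (F z)))"

definition holomorphic_stem :: "complex set \<Rightarrow> (complex \<Rightarrow> 'a \<times> 'a::alternative_star_algebra) \<Rightarrow> bool" where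
  "holomorphic_stem D F \<longleftrightarrow>
     (\<forall>z\<in>D. \<exists>F'. (F has_derivative F') (at z) \<and>
            (\<forall>w. F' (\<i> * w) = (- snd (F' w), fst (F' w))))"

definition real_stem :: "complex set \<Rightarrow> (complex \<Rightarrow> 'a \<times> 'a::alternative_star_algebra) \<Rightarrow> bool" where
  "real_stem D F \<longleftrightarrow> (\<forall>z\<in>D. fst (F z) \<in> span {1} \<and> snd (F z) \<in> span {1})"

definition induces ::
    "complex set \<Rightarrow> (complex \<Rightarrow> 'a \<times> 'a) \<Rightarrow> ('a \<Rightarrow> 'a::alternative_star_algebra) \<Rightarrow> bool" where
  "induces D F g \<longleftrightarrow>
     (\<forall>z\<in>D. \<forall>J\<in>imag_units. g (Re z *\<^sub>R 1 + Im z *\<^sub>R J) = fst (F z) + J * snd (F z))"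

text \<open>
  In the following, \<open>W\<close> is a subset of \<open>circularization D\<close>: slice functions on \<open>W\<close>
  are restrictions of slice functions on \<open>circularization D\<close>.
\<close>

definition slice_with_stem ::
    "complex set \<Rightarrow> 'a set \<Rightarrow> (complex \<Rightarrow> 'a \<times> 'a) \<Rightarrow> ('a \<Rightarrow> 'a::alternative_star_algebra) \<Rightarrow> bool" where
  "slice_with_stem D W F f \<longleftrightarrow>
     stem_function D F \<and> (\<exists>g. induces D F g \<and> (\<forall>x\<in>W. f x = g x))"

definition slice_on :: "complex set \<Rightarrow> 'a set \<Rightarrow> ('a \<Rightarrow> 'a::alternative_star_algebra) \<Rightarrow> bool" where
  "slice_on D W f \<longleftrightarrow> (\<exists>F. slice_with_stem D W F f)"

definition slice_regular_on :: "complex set \<Rightarrow> 'a set \<Rightarrow> ('a \<Rightarrow> 'a::alternative_star_algebra) \<Rightarrow> bool" where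
  "slice_regular_on D W f \<longleftrightarrow> (\<exists>F. slice_with_stem D W F f \<and> holomorphic_stem D F)"

definition slice_preserving_on :: "complex set \<Rightarrow> 'a set \<Rightarrow> ('a \<Rightarrow> 'a::alternative_star_algebra) \<Rightarrow> bool" where
  "slice_preserving_on D W f \<longleftrightarrow> (\<exists>F. slice_with_stem D W F f \<and> real_stem D F)"

end

theory Submission
  imports Defs "HOL-Complex_Analysis.Complex_Analysis" "HOL-Real_Asymp.Real_Asymp"
begin

text \<open>
  For \<open>\<psi>\<close> holomorphic on \<open>D\<close> let \<open>dd q \<psi> z\<close> be the sum of the residues of \<open>\<psi> / Q ^ (q + 1)\<close> at \<open>z\<close> and its
  conjugate, where \<open>Q w = (w - z) (w - cnj z)\<close>. It depends on \<open>z\<close> only through \<open>Re z\<close> and \<open>|z|\<^sup>2\<close>, so it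
  defines a smooth axially symmetric function on \<open>\<Omega>\<close>. If \<open>F\<close> is the stem function of \<open>f\<close>, then
  \<open>f x = dd 0 (w F) - star x * dd 0 F\<close>. Differentiation of \<open>1 / Q ^ (q + 1)\<close> shows that \<open>\<Delta> (dd q \<psi>)\<close> is
  \<open>2 (q + 1) (2 q + 3 - m) dd (q + 1) \<psi>\<close>. For \<open>q = n = (m - 3) / 2\<close> this vanishes, and then the functions
  \<open>dd n \<alpha> - star x * dd n \<beta>\<close> lie in the kernels of the conjugate derivative of the Laplacian and of the
  bilaplacian, for arbitrary holomorphic \<open>\<alpha>\<close> and \<open>\<beta>\<close>.

  It remains to write \<open>dd 0 \<phi>\<close> as a sum of terms \<open>|z| ^ (2 k) dd n \<psi>\<close> with \<open>k \<le> n\<close>, which is done by raising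
  \<open>q\<close> one step at a time. Polynomials of degree at most \<open>2 q\<close> are annihilated by \<open>dd q\<close>, so \<open>\<phi>\<close> may be taken
  of the form \<open>w ^ (q + 1) k\<close>. Since \<open>D\<close> is star-like, \<open>(q + 1) k\<close> has a primitive \<open>\<kappa>\<close> on \<open>D\<close>, and
  integrating the derivative of \<open>w ^ (q + 1) \<kappa> / Q ^ (q + 1)\<close> gives
  \<open>dd q \<phi> = dd (q + 1) (w ^ (q + 2) \<kappa>) - |z|\<^sup>2 dd (q + 1) (w ^ q \<kappa>)\<close>.
\<close>

section \<open>Residue sums at conjugate points\<close>

definition quad :: "complex \<Rightarrow> complex \<Rightarrow> complex" where
  "quad z w = (w - z) * (w - cnj z)"

text \<open>The index set collapses to one point when \<open>z\<close> is real, so the merged pole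
  is counted once.\<close>

definition dd :: "nat \<Rightarrow> (complex \<Rightarrow> complex) \<Rightarrow> complex \<Rightarrow> complex" where
  "dd q \<psi> z = (\<Sum>p\<in>{z, cnj z}. residue (\<lambda>w. \<psi> w / quad z w ^ Suc q) p)"

definition circ :: "complex \<Rightarrow> real \<Rightarrow> (complex \<Rightarrow> complex) \<Rightarrow> complex" where
  "circ c r g = contour_integral (circlepath c r) g / (2 * pi * \<i>)"

text \<open>Circles of radius below \<open>R\<close> about \<open>z\<close> and \<open>cnj z\<close>
  separate the two poles, or coincide and enclose both if \<open>z\<close> is real. The same circles
  serve all points near \<open>z\<close>.\<close>

definition isolating :: "complex set \<Rightarrow> complex \<Rightarrow> real \<Rightarrow> bool" where
  "isolating D z R \<longleftrightarrow> ball z R \<subseteq> D \<and> ball (cnj z) R \<subseteq> D \<and>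
     (z = cnj z \<or> ball z R \<inter> ball (cnj z) R = {})"

lemma quad_alt: "quad z w = w\<^sup>2 - 2 * of_real (Re z) * w + of_real ((cmod z)\<^sup>2)"
proof -
  have "quad z w = w\<^sup>2 - (z + cnj z) * w + z * cnj z"
    by (simp add: quad_def algebra_simps power2_eq_square)
  then show ?thesis
    by (simp add: complex_add_cnj complex_norm_square [symmetric])
qed

lemma quad_eq_0_iff: "quad z w = 0 \<longleftrightarrow> w = z \<or> w = cnj z"
  by (simp add: quad_def)

lemma quad_cnj: "quad (cnj z) w = quad z w"
  by (simp add: quad_def mult.commute)

lemma dist_cnj_cnj: "dist (cnj z) (cnj w) = dist z w"
  by (metis complex_cnj_diff complex_mod_cnj dist_norm)

lemma dd_cnj: "dd q \<psi> (cnj z) = dd q \<psi> z"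
  by (simp add: dd_def quad_cnj insert_commute)

lemma circ_cong:
  assumes "r > 0" and "\<And>w. cmod (w - c) = r \<Longrightarrow> f w = g w"
  shows "circ c r f = circ c r g"
proof -
  have "contour_integral (circlepath c r) f = contour_integral (circlepath c r) g"
    using assms by (intro contour_integral_eq) (auto simp: dist_norm norm_minus_commute)
  then show ?thesis by (simp add: circ_def)
qed

lemma circ_residues:
  assumes "R > r" "r > 0" "finite P" "P \<subseteq> ball c r" "g holomorphic_on ball c R - P"
  shows "circ c r g = (\<Sum>p\<in>P. residue g p)"
proof -
  have "contour_integral (circlepath c r) g
      = 2 * pi * \<i> * (\<Sum>p\<in>P. winding_number (circlepath c r) p * residue g p)"
  proof (rule Residue_theorem [where S = "ball c R"])
    show "path_image (circlepath c r) \<subseteq> ball c R - P"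
      using assms by (auto simp: subset_iff)
    show "\<forall>z. z \<notin> ball c R \<longrightarrow> winding_number (circlepath c r) z = 0"
    proof (intro allI impI)
      fix z assume "z \<notin> ball c R"
      then show "winding_number (circlepath c r) z = 0"
        using assms
        by (intro winding_number_zero_outside [where s = "cball c r"]) (auto simp: subset_iff dist_norm)
    qed
  qed (use assms in auto)
  also have "(\<Sum>p\<in>P. winding_number (circlepath c r) p * residue g p) = (\<Sum>p\<in>P. residue g p)"
    using assms
    by (intro sum.cong) (auto simp: winding_number_circlepath subset_iff dist_norm norm_minus_commute)
  finally show ?thesis by (simp add: circ_def)
qed

locale cnj_domain =
  fixes D :: "complex set"
  assumes open_D: "open D" and cnj_D: "z \<in> D \<Longrightarrow> cnj z \<in> D"
begin

lemma isolating_exists: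
  assumes "z \<in> D"
  obtains R where "R > 0" "isolating D z R"
proof -
  obtain e where e: "e > 0" "ball z e \<subseteq> D"
    using open_D assms by (meson openE)
  have e2: "ball (cnj z) e \<subseteq> D"
  proof
    fix w assume "w \<in> ball (cnj z) e"
    then have "cnj w \<in> ball z e"
      by (metis complex_cnj_cnj dist_cnj_cnj mem_ball)
    then show "w \<in> D" using e cnj_D by (metis complex_cnj_cnj subsetD)
  qed
  define R where "R = (if z = cnj z then e else min e (dist z (cnj z) / 2))"
  have "R > 0" "R \<le> e" using e by (auto simp: R_def)
  moreover have "z = cnj z \<or> ball z R \<inter> ball (cnj z) R = {}"
  proof (cases "z = cnj z")
    case False
    then have "2 * R \<le> dist z (cnj z)" by (simp add: R_def)
    then have "R + R \<le> dist z (cnj z)" by linarith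
    then show ?thesis using disjoint_ballI by blast
  qed simp
  ultimately have "isolating D z R"
    using e e2 unfolding isolating_def by (meson subset_ball subset_trans)
  with \<open>R > 0\<close> show ?thesis by (rule that)
qed

text \<open>The residue theorem yields contours that depend on \<open>z0\<close> only, while
  \<open>z\<close> moves inside them. Hence \<open>dd\<close> can be differentiated under the
  integral sign, even near real points, where the poles merge.\<close>

lemma dd_circ:
  assumes iso: "isolating D z0 R" and r: "0 < r" "r < R" and z: "z \<in> ball z0 r"
    and hol: "\<psi> holomorphic_on D"
  shows "dd q \<psi> z = (\<Sum>c\<in>{z0, cnj z0}. circ c r (\<lambda>w. \<psi> w / quad z w ^ Suc q))"
proof -
  let ?g = "\<lambda>w. \<psi> w / quad z w ^ Suc q"
  have z': "cnj z \<in> ball (cnj z0) r"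
    using z by (simp add: dist_cnj_cnj)
  have holg: "?g holomorphic_on ball c R - P" if "ball c R \<subseteq> D" "{z, cnj z} \<inter> ball c R \<subseteq> P" for c P
    using that hol by (intro holomorphic_intros) (auto simp: quad_eq_0_iff quad_def intro!: holomorphic_intros elim: holomorphic_on_subset)
  show ?thesis
  proof (cases "z0 = cnj z0")
    case True
    have "circ z0 r ?g = (\<Sum>p\<in>{z, cnj z}. residue ?g p)"
      using True z z' iso r by (intro circ_residues [where R = R] holg) (auto simp: isolating_def)
    then show ?thesis using True by (simp add: dd_def)
  next
    case False
    then have dj: "ball z0 R \<inter> ball (cnj z0) R = {}" using iso by (simp add: isolating_def)
    have "z \<in> ball z0 R" "cnj z \<in> ball (cnj z0) R" using z z' r by auto
    \<comment> \<open>Disjointness of the isolating balls leaves exactly one pole inside each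
      circle.\<close>
    then have n: "z \<notin> ball (cnj z0) R" "cnj z \<notin> ball z0 R" "z \<noteq> cnj z" using dj by (blast, blast, metis disjoint_iff)
    have "circ z0 r ?g = (\<Sum>p\<in>{z}. residue ?g p)"
      using n z z' iso r by (intro circ_residues [where R = R] holg) (auto simp: isolating_def)
    moreover have "circ (cnj z0) r ?g = (\<Sum>p\<in>{cnj z}. residue ?g p)"
      using n z z' iso r by (intro circ_residues [where R = R] holg) (auto simp: isolating_def)
    ultimately show ?thesis using False n by (simp add: dd_def)
  qed
qed

text \<open>A pole on one of the circles would be nearer than \<open>r\<close> to one centre and at
  distance \<open>r\<close> from the other, hence lie in both isolating balls.\<close>

lemma quad_nz_circle:
  assumes "isolating D z0 R" "0 < r" "r < R" "z \<in> ball z0 r" "c \<in> {z0, cnj z0}" "cmod (w - c) = r"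
  shows "quad z w \<noteq> 0"
proof
  assume "quad z w = 0"
  then have w: "w = z \<or> w = cnj z" by (simp add: quad_eq_0_iff)
  have "dist z0 z < r" using assms by simp
  moreover have "dist c w = r" using assms by (simp add: dist_norm norm_minus_commute)
  ultimately have d: "dist z0 z < r" "dist (cnj z0) (cnj z) < r" "dist c w = r"
    by (simp_all add: dist_cnj_cnj)
  from w have "w \<in> ball z0 R \<and> w \<in> ball (cnj z0) R \<and> z0 \<noteq> cnj z0"
  proof
    assume "w = z"
    then have "c \<noteq> z0" "dist z0 w < R" using d assms(3) by auto
    then show ?thesis using assms(3,5) d by auto
  next
    assume "w = cnj z"
    then have "c \<noteq> cnj z0" "dist (cnj z0) w < R" using d assms(3) by auto
    then show ?thesis using assms(3,5) d by auto
  qed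
  then show False using assms(1) unfolding isolating_def by blast
qed

lemma circle_in_domain:
  assumes "isolating D z0 R" "r < R" "c \<in> {z0, cnj z0}" "cmod (w - c) = r"
  shows "w \<in> D"
  using assms by (auto simp: isolating_def subset_iff dist_norm norm_minus_commute)

end

section \<open>Normalized integrals over circles\<close>

lemma circ_integral:
  "circ c r g = integral (cbox 0 1) (\<lambda>\<theta>. g (c + r * exp (2 * pi * \<i> * of_real \<theta>)) * (r * exp (2 * pi * \<i> * of_real \<theta>)))"
proof -
  have "contour_integral (circlepath c r) g
      = integral (cbox 0 1) (\<lambda>\<theta>. (2 * pi * \<i>) * (g (c + r * exp (2 * pi * \<i> * of_real \<theta>)) * (r * exp (2 * pi * \<i> * of_real \<theta>))))"
    unfolding contour_integral_integral vector_derivative_circlepath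
    by (simp add: circlepath mult_ac)
  then show ?thesis by (simp add: circ_def integral_mult_right)
qed

lemma contour_integrable_circ:
  assumes "r > 0" "continuous_on {w. cmod (w - c) = r} f"
  shows "f contour_integrable_on circlepath c r"
  using assms by (intro contour_integrable_continuous_circlepath)
    (auto simp: path_image_circlepath sphere_def dist_norm norm_minus_commute)

lemma circ_add:
  assumes "r > 0" "continuous_on {w. cmod (w - c) = r} f" "continuous_on {w. cmod (w - c) = r} g"
  shows "circ c r (\<lambda>w. f w + g w) = circ c r f + circ c r g"
  using contour_integrable_circ [OF assms(1,2)] contour_integrable_circ [OF assms(1,3)]
  by (simp add: circ_def contour_integral_add add_divide_distrib)

lemma circ_cmul:
  assumes "r > 0" "continuous_on {w. cmod (w - c) = r} f"
  shows "circ c r (\<lambda>w. a * f w) = a * circ c r f"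
  using contour_integrable_circ [OF assms]
  by (simp add: circ_def contour_integral_lmul)

lemma circ_derivative:
  assumes "r > 0" "\<And>w. cmod (w - c) = r \<Longrightarrow> (F has_field_derivative f w) (at w)"
  shows "circ c r f = 0"
proof -
  have "(f has_contour_integral 0) (circlepath c r)"
    by (rule Cauchy_theorem_primitive [where S = "sphere c r"])
      (use assms in \<open>auto simp: dist_norm norm_minus_commute intro: has_field_derivative_at_within\<close>)
  then show ?thesis by (simp add: circ_def contour_integral_unique)
qed

section \<open>Algebraic rules for residue sums\<close>

context cnj_domain
begin

text \<open>Agreement is only given on \<open>D\<close>, so the residues are compared through
  circles inside \<open>D\<close>.\<close>

lemma dd_cong:
  assumes "\<psi> holomorphic_on D" "z \<in> D" "\<And>w. w \<in> D \<Longrightarrow> \<psi> w = \<phi> w"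
  shows "dd q \<psi> z = dd q \<phi> z"
proof -
  obtain R where R: "R > 0" "isolating D z R" using isolating_exists assms by blast
  have "\<phi> holomorphic_on D" using assms holomorphic_transform by blast
  then have "dd q \<phi> z = (\<Sum>c\<in>{z, cnj z}. circ c (R/2) (\<lambda>w. \<phi> w / quad z w ^ Suc q))"
    using R by (intro dd_circ) auto
  also have "\<dots> = (\<Sum>c\<in>{z, cnj z}. circ c (R/2) (\<lambda>w. \<psi> w / quad z w ^ Suc q))"
  proof (intro sum.cong refl circ_cong)
    fix c w assume "c \<in> {z, cnj z}" "cmod (w - c) = R/2"
    then have "w \<in> D" using R circle_in_domain [OF R(2), of "R/2"] by simp
    then show "\<phi> w / quad z w ^ Suc q = \<psi> w / quad z w ^ Suc q" using assms(3) by simp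
  qed (use R in simp)
  also have "\<dots> = dd q \<psi> z"
    using R assms by (intro dd_circ [symmetric]) auto
  finally show ?thesis by simp
qed

text \<open>One radius serves all residue sums at \<open>z\<close>, so identities between integrands
  on the circles carry over to \<open>dd\<close>. The bound on \<open>2 * r\<close> keeps
  \<open>z\<close> outside the circle about a distinct \<open>cnj z\<close>.\<close>

lemma dd_eval:
  assumes "z \<in> D"
  obtains r where "r > 0" "\<And>c. c \<in> {z, cnj z} \<Longrightarrow> cball c r \<subseteq> D"
    "\<And>c w. c \<in> {z, cnj z} \<Longrightarrow> cmod (w - c) = r \<Longrightarrow> w \<in> D \<and> quad z w \<noteq> 0"
    "z \<noteq> cnj z \<Longrightarrow> 2 * r \<le> dist z (cnj z)"
    "\<And>q \<psi>. \<psi> holomorphic_on D \<Longrightarrow>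
       dd q \<psi> z = (\<Sum>c\<in>{z, cnj z}. circ c r (\<lambda>w. \<psi> w / quad z w ^ Suc q))"
proof -
  obtain R where R: "R > 0" "isolating D z R" using isolating_exists assms by blast
  have sep: "2 * (R/2) \<le> dist z (cnj z)" if "z \<noteq> cnj z"
  proof (rule ccontr)
    assume "\<not> ?thesis"
    then have "z \<in> ball z R" "z \<in> ball (cnj z) R" using R by (auto simp: dist_commute)
    then show False using R that unfolding isolating_def by (metis IntI empty_iff)
  qed
  show ?thesis
  proof (rule that [of "R/2"])
    show "cball c (R/2) \<subseteq> D" if "c \<in> {z, cnj z}" for c
      using R that by (fastforce simp: isolating_def subset_iff)
    show "w \<in> D \<and> quad z w \<noteq> 0" if "c \<in> {z, cnj z}" "cmod (w - c) = R/2" for c w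
      using that R circle_in_domain [OF R(2), of "R/2"] quad_nz_circle [OF R(2), of "R/2" z] by auto
    show "dd q \<psi> z = (\<Sum>c\<in>{z, cnj z}. circ c (R/2) (\<lambda>w. \<psi> w / quad z w ^ Suc q))"
      if "\<psi> holomorphic_on D" for q \<psi>
      using R that by (intro dd_circ) auto
  qed (use R sep in auto)
qed

lemma continuous_quotient:
  assumes "\<psi> holomorphic_on D" "\<And>w. w \<in> S \<Longrightarrow> w \<in> D \<and> quad z w \<noteq> 0"
  shows "continuous_on S (\<lambda>w. \<psi> w / quad z w ^ n)"
proof -
  have "continuous_on S \<psi>"
    using assms holomorphic_on_imp_continuous_on continuous_on_subset by (metis subsetI)
  moreover have "continuous_on S (quad z)"
    unfolding quad_def by (intro continuous_intros)
  ultimately show ?thesis using assms by (intro continuous_intros) auto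
qed

lemma dd_add:
  assumes "\<psi> holomorphic_on D" "\<phi> holomorphic_on D" "z \<in> D"
  shows "dd q (\<lambda>w. \<psi> w + \<phi> w) z = dd q \<psi> z + dd q \<phi> z"
proof -
  from assms(3) obtain r where r: "r > 0"
    "\<And>c w. c \<in> {z, cnj z} \<Longrightarrow> cmod (w - c) = r \<Longrightarrow> w \<in> D \<and> quad z w \<noteq> 0"
    "\<And>q \<psi>. \<psi> holomorphic_on D \<Longrightarrow>
       dd q \<psi> z = (\<Sum>c\<in>{z, cnj z}. circ c r (\<lambda>w. \<psi> w / quad z w ^ Suc q))"
    by (rule dd_eval) blast
  have "dd q (\<lambda>w. \<psi> w + \<phi> w) z
      = (\<Sum>c\<in>{z, cnj z}. circ c r (\<lambda>w. \<psi> w / quad z w ^ Suc q + \<phi> w / quad z w ^ Suc q))"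
    using assms by (subst r(3)) (auto intro!: holomorphic_intros simp: add_divide_distrib)
  also have "\<dots> = (\<Sum>c\<in>{z, cnj z}. circ c r (\<lambda>w. \<psi> w / quad z w ^ Suc q) + circ c r (\<lambda>w. \<phi> w / quad z w ^ Suc q))"
    using r assms by (intro sum.cong circ_add continuous_quotient) auto
  finally show ?thesis using assms by (simp add: r(3) sum.distrib)
qed

lemma dd_cmul:
  assumes "\<psi> holomorphic_on D" "z \<in> D"
  shows "dd q (\<lambda>w. a * \<psi> w) z = a * dd q \<psi> z"
proof -
  from assms(2) obtain r where r: "r > 0"
    "\<And>c w. c \<in> {z, cnj z} \<Longrightarrow> cmod (w - c) = r \<Longrightarrow> w \<in> D \<and> quad z w \<noteq> 0"
    "\<And>q \<psi>. \<psi> holomorphic_on D \<Longrightarrow>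
       dd q \<psi> z = (\<Sum>c\<in>{z, cnj z}. circ c r (\<lambda>w. \<psi> w / quad z w ^ Suc q))"
    by (rule dd_eval) blast
  have "dd q (\<lambda>w. a * \<psi> w) z = (\<Sum>c\<in>{z, cnj z}. circ c r (\<lambda>w. a * (\<psi> w / quad z w ^ Suc q)))"
    using assms by (subst r(3)) (auto intro!: holomorphic_intros)
  also have "\<dots> = (\<Sum>c\<in>{z, cnj z}. a * circ c r (\<lambda>w. \<psi> w / quad z w ^ Suc q))"
    using r assms by (intro sum.cong circ_cmul continuous_quotient) auto
  finally show ?thesis using assms by (simp add: r(3) sum_distrib_left)
qed

lemma dd_quad:
  assumes "\<psi> holomorphic_on D" "z \<in> D"
  shows "dd (Suc q) (\<lambda>w. quad z w * \<psi> w) z = dd q \<psi> z"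
proof -
  from assms(2) obtain r where r: "r > 0"
    "\<And>c w. c \<in> {z, cnj z} \<Longrightarrow> cmod (w - c) = r \<Longrightarrow> w \<in> D \<and> quad z w \<noteq> 0"
    "\<And>q \<psi>. \<psi> holomorphic_on D \<Longrightarrow>
       dd q \<psi> z = (\<Sum>c\<in>{z, cnj z}. circ c r (\<lambda>w. \<psi> w / quad z w ^ Suc q))"
    by (rule dd_eval) blast
  have "(\<lambda>w. quad z w * \<psi> w) holomorphic_on D"
    unfolding quad_def using assms by (intro holomorphic_intros)
  then have "dd (Suc q) (\<lambda>w. quad z w * \<psi> w) z
      = (\<Sum>c\<in>{z, cnj z}. circ c r (\<lambda>w. quad z w * \<psi> w / quad z w ^ Suc (Suc q)))"
    by (rule r(3))
  also have "\<dots> = (\<Sum>c\<in>{z, cnj z}. circ c r (\<lambda>w. \<psi> w / quad z w ^ Suc q))"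
    using r assms by (intro sum.cong circ_cong) auto
  finally show ?thesis using assms by (simp add: r(3))
qed

text \<open>The derivative of \<open>\<psi> / quad z ^ Suc q\<close> integrates to zero over the
  circles. The quotient rule splits it into a term with \<open>\<psi>'\<close> and one with the
  derivative \<open>2 * (w - Re z)\<close> of \<open>quad z\<close>.\<close>

lemma dd_total_derivative:
  assumes "\<psi> holomorphic_on D" "\<And>w. w \<in> D \<Longrightarrow> (\<psi> has_field_derivative \<psi>' w) (at w)" "z \<in> D"
  shows "dd q \<psi>' z = of_nat (Suc q) * dd (Suc q) (\<lambda>w. 2 * (w - of_real (Re z)) * \<psi> w) z"
proof -
  from assms(3) obtain r where r: "r > 0"
    "\<And>c w. c \<in> {z, cnj z} \<Longrightarrow> cmod (w - c) = r \<Longrightarrow> w \<in> D \<and> quad z w \<noteq> 0"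
    "\<And>q \<psi>. \<psi> holomorphic_on D \<Longrightarrow>
       dd q \<psi> z = (\<Sum>c\<in>{z, cnj z}. circ c r (\<lambda>w. \<psi> w / quad z w ^ Suc q))"
    by (rule dd_eval) blast
  let ?\<chi> = "\<lambda>w. 2 * (w - of_real (Re z)) * \<psi> w"
  have "\<psi>' holomorphic_on D"
    using assms(1,2) open_D holomorphic_deriv DERIV_imp_deriv holomorphic_transform by metis
  moreover have \<chi>: "?\<chi> holomorphic_on D"
    using assms by (intro holomorphic_intros)
  ultimately have "dd q \<psi>' z - of_nat (Suc q) * dd (Suc q) ?\<chi> z
    = (\<Sum>c\<in>{z, cnj z}. circ c r (\<lambda>w. \<psi>' w / quad z w ^ Suc q) + (- of_nat (Suc q)) * circ c r (\<lambda>w. ?\<chi> w / quad z w ^ Suc (Suc q)))"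
    by (simp add: r(3) sum.distrib sum_distrib_left sum_negf sum_subtractf del: of_nat_Suc power_Suc)
  also have "\<dots> = (\<Sum>c\<in>{z, cnj z}. circ c r (\<lambda>w. \<psi>' w / quad z w ^ Suc q + (- of_nat (Suc q)) * (?\<chi> w / quad z w ^ Suc (Suc q))))"
  proof (intro sum.cong refl)
    fix c assume c: "c \<in> {z, cnj z}"
    have 1: "continuous_on {w. cmod (w - c) = r} (\<lambda>w. \<psi>' w / quad z w ^ Suc q)"
      using r c by (intro continuous_quotient \<open>\<psi>' holomorphic_on D\<close>) auto
    have 2: "continuous_on {w. cmod (w - c) = r} (\<lambda>w. ?\<chi> w / quad z w ^ Suc (Suc q))"
      using r c by (intro continuous_quotient \<chi>) auto
    show "circ c r (\<lambda>w. \<psi>' w / quad z w ^ Suc q) + (- of_nat (Suc q)) * circ c r (\<lambda>w. ?\<chi> w / quad z w ^ Suc (Suc q))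
      = circ c r (\<lambda>w. \<psi>' w / quad z w ^ Suc q + (- of_nat (Suc q)) * (?\<chi> w / quad z w ^ Suc (Suc q)))"
      using circ_add [OF r(1) 1 continuous_on_mult_left [OF 2]] circ_cmul [OF r(1) 2] by metis
  qed
  also have "\<dots> = 0"
  proof (intro sum.neutral ballI, rule circ_derivative [OF r(1)])
    fix c w assume "c \<in> {z, cnj z}" "cmod (w - c) = r"
    then have w: "w \<in> D" "quad z w \<noteq> 0" using r(2) by auto
    have "(quad z has_field_derivative 2 * (w - of_real (Re z))) (at w)"
      unfolding quad_alt [abs_def]
      by (auto intro!: derivative_eq_intros simp: power2_eq_square algebra_simps)
    note dp = DERIV_power [OF this, of "Suc q"]
    have "((\<lambda>w. \<psi> w / quad z w ^ Suc q) has_field_derivative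
      (\<psi>' w * quad z w ^ Suc q - \<psi> w * (of_nat (Suc q) * (2 * (w - of_real (Re z)) * quad z w ^ (Suc q - Suc 0)))) / (quad z w ^ Suc q * quad z w ^ Suc q)) (at w)"
      by (rule DERIV_divide [OF assms(2) [OF w(1)] dp]) (use w in simp)
    moreover have "(\<psi>' w * quad z w ^ Suc q - \<psi> w * (of_nat (Suc q) * (2 * (w - of_real (Re z)) * quad z w ^ (Suc q - Suc 0)))) / (quad z w ^ Suc q * quad z w ^ Suc q)
       = \<psi>' w / quad z w ^ Suc q + (- of_nat (Suc q)) * (?\<chi> w / quad z w ^ Suc (Suc q))"
      using w by (simp add: divide_simps) (simp add: algebra_simps)
    ultimately show "((\<lambda>w. \<psi> w / quad z w ^ Suc q) has_field_derivative
      \<psi>' w / quad z w ^ Suc q + (- of_nat (Suc q)) * (?\<chi> w / quad z w ^ Suc (Suc q))) (at w)"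
      by simp
  qed
  finally show ?thesis by simp
qed

end

section \<open>Differentiation of residue sums under the integral sign\<close>

lemma has_vector_derivative_quotient_power:
  fixes h :: "real \<Rightarrow> complex"
  assumes "(h has_vector_derivative (- h')) (at t)" "h t \<noteq> 0"
  shows "((\<lambda>t. K / h t ^ Suc q * E) has_vector_derivative of_nat (Suc q) * (h' * K / h t ^ Suc (Suc q) * E)) (at t)"
proof -
  have "((\<lambda>w. K / w ^ Suc q) has_field_derivative - of_nat (Suc q) * K / h t ^ Suc (Suc q)) (at (h t))"
  proof -
    have "((\<lambda>w. K / w ^ Suc q) has_field_derivative
      (0 * h t ^ Suc q - K * (of_nat (Suc q) * (1 * h t ^ (Suc q - Suc 0)))) / (h t ^ Suc q * h t ^ Suc q)) (at (h t))"
      by (intro DERIV_divide DERIV_const DERIV_power DERIV_ident) (use assms in simp)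
    then show ?thesis
      by (rule DERIV_cong) (use assms in \<open>simp add: field_simps\<close>)
  qed
  then have "((\<lambda>w. K / w ^ Suc q * E) has_field_derivative - of_nat (Suc q) * K / h t ^ Suc (Suc q) * E) (at (h t))"
    by (rule DERIV_cmult_right)
  from field_vector_diff_chain_at [OF assms(1) this]
  show ?thesis by (simp add: o_def mult_ac del: power_Suc of_nat_Suc)
qed

context cnj_domain
begin

lemma dd_lincomb:
  assumes "\<psi> holomorphic_on D" "\<phi> holomorphic_on D" "z \<in> D"
  shows "dd q (\<lambda>w. a * \<psi> w + b * \<phi> w) z = a * dd q \<psi> z + b * dd q \<phi> z"
proof -
  have "(\<lambda>w. a * \<psi> w) holomorphic_on D" "(\<lambda>w. b * \<phi> w) holomorphic_on D"
    using assms by (auto intro!: holomorphic_intros)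
  then show ?thesis using assms by (simp add: dd_add dd_cmul)
qed

text \<open>Joint continuity in parameter and angle is what parametric integrals and the Leibniz
  rule require. The affine factor covers both the integrand (\<open>a = 0\<close>,
  \<open>b = 1\<close>) and its parameter derivative, whose numerator gains a factor affine in
  \<open>w\<close>.\<close>

lemma continuous_circle_integrand:
  assumes iso: "isolating D z0 R" "0 < r" "r < R" and c: "c \<in> {z0, cnj z0}"
    and hol: "\<psi> holomorphic_on D"
    and z: "continuous_on U z" "z ` U \<subseteq> ball z0 r"
    and a: "continuous_on U a" "continuous_on U b"
  shows "continuous_on (U \<times> cbox 0 1) (\<lambda>(x, \<theta>::real). let w = c + r * exp (2 * pi * \<i> * of_real \<theta>) in
    (a x * w + b x) * \<psi> w / quad (z x) w ^ n * (r * exp (2 * pi * \<i> * of_real \<theta>)))"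
proof -
  let ?w = "\<lambda>p :: 'a \<times> real. c + r * exp (2 * pi * \<i> * of_real (snd p))"
  have w: "cmod (?w p - c) = r" for p
    using iso by (simp add: norm_mult)
  have cw: "continuous_on (U \<times> cbox 0 1) ?w"
    by (intro continuous_intros)
  have "continuous_on D \<psi>" using hol by (rule holomorphic_on_imp_continuous_on)
  then have 1: "continuous_on (U \<times> cbox 0 1) (\<lambda>p. \<psi> (?w p))"
    by (rule continuous_on_compose2 [OF _ cw]) (use w circle_in_domain [OF iso(1,3) c] in blast)
  have zf: "continuous_on (U \<times> cbox 0 (1::real)) (\<lambda>p. z (fst p))"
    by (rule continuous_on_compose2 [OF z(1)]) (auto intro: continuous_intros)
  have af: "continuous_on (U \<times> cbox 0 (1::real)) (\<lambda>p. a (fst p))"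
    by (rule continuous_on_compose2 [OF a(1)]) (auto intro: continuous_intros)
  have bf: "continuous_on (U \<times> cbox 0 (1::real)) (\<lambda>p. b (fst p))"
    by (rule continuous_on_compose2 [OF a(2)]) (auto intro: continuous_intros)
  have 2: "continuous_on (U \<times> cbox 0 1) (\<lambda>p. quad (z (fst p)) (?w p))"
    unfolding quad_def by (intro continuous_intros zf)
  have "quad (z (fst p)) (?w p) \<noteq> 0" if "p \<in> U \<times> cbox 0 1" for p
    using that z(2) by (intro quad_nz_circle [OF iso _ c w]) auto
  then have "continuous_on (U \<times> cbox 0 1) (\<lambda>p. (a (fst p) * ?w p + b (fst p)) * \<psi> (?w p) / quad (z (fst p)) (?w p) ^ n * (r * exp (2 * pi * \<i> * of_real (snd p))))"
    by (intro continuous_intros cw 1 2 af bf) auto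
  then show ?thesis by (simp add: case_prod_unfold Let_def)
qed

lemma continuous_on_dd:
  assumes "\<psi> holomorphic_on D"
  shows "continuous_on D (dd q \<psi>)"
proof (rule continuous_at_imp_continuous_on, rule ballI)
  fix z0 assume "z0 \<in> D"
  then obtain R where R: "R > 0" "isolating D z0 R" using isolating_exists by blast
  define r where "r = R/2"
  have r: "0 < r" "r < R" using R by (auto simp: r_def)
  have "continuous_on (ball z0 r) (\<lambda>z. \<Sum>c\<in>{z0, cnj z0}. circ c r (\<lambda>w. \<psi> w / quad z w ^ Suc q))"
    unfolding circ_integral
  proof (intro continuous_on_sum integral_continuous_on_param)
    fix c assume c: "c \<in> {z0, cnj z0}"
    show "continuous_on (ball z0 r \<times> cbox 0 1) (\<lambda>(z, \<theta>). \<psi> (c + r * exp (2 * pi * \<i> * of_real \<theta>)) /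
      quad z (c + r * exp (2 * pi * \<i> * of_real \<theta>)) ^ Suc q * (r * exp (2 * pi * \<i> * of_real \<theta>)))"
      using continuous_circle_integrand [OF R(2) r c assms, of "ball z0 r" "\<lambda>z. z" "\<lambda>_. 0" "\<lambda>_. 1" "Suc q"]
      by (simp add: Let_def del: power_Suc)
  qed
  then have "continuous_on (ball z0 r) (dd q \<psi>)"
    by (rule continuous_on_eq) (simp only: dd_circ [OF R(2) r _ assms])
  then show "isCont (dd q \<psi>) z0"
    using r by (simp add: continuous_on_eq_continuous_at)
qed

text \<open>
  The curve is prescribed through \<open>Re z\<close> and \<open>|z|\<^sup>2\<close>, the two quantities on which \<open>dd\<close> depends: they are
  polynomial along a line in a hypercomplex subspace, even where \<open>z\<close> itself is not differentiable.
\<close>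

lemma has_vector_derivative_dd:
  fixes z :: "real \<Rightarrow> complex"
  assumes hol: "\<psi> holomorphic_on D" and z0: "z 0 \<in> D" and cz: "continuous_on UNIV z"
    and re: "\<And>t. Re (z t) = a + c * t" and nm: "\<And>t. (cmod (z t))\<^sup>2 = s + 2 * b * t + d * t\<^sup>2"
  shows "((\<lambda>t. dd q \<psi> (z t)) has_vector_derivative
    of_nat (Suc q) * (of_real (2 * c) * dd (Suc q) (\<lambda>w. w * \<psi> w) (z 0) - of_real (2 * b) * dd (Suc q) \<psi> (z 0))) (at 0)"
proof -
  obtain R where R: "R > 0" "isolating D (z 0) R" using isolating_exists z0 by blast
  define r where "r = R/2"
  have r: "0 < r" "r < R" using R by (auto simp: r_def)
  have "open (z -` ball (z 0) r)" "0 \<in> z -` ball (z 0) r"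
    using open_vimage [OF open_ball cz] r by auto
  \<comment> \<open>Continuity of the curve keeps \<open>z t\<close> inside the fixed contours for
    small \<open>t\<close>.\<close>
  then obtain e where e: "e > 0" "ball 0 e \<subseteq> z -` ball (z 0) r" by (meson openE)
  have zU: "z ` ball 0 e \<subseteq> ball (z 0) r" using e by auto
  have czU: "continuous_on (ball 0 e) z" using cz continuous_on_subset by blast
  let ?W = "\<lambda>k \<theta>. k + r * exp (2 * pi * \<i> * of_real \<theta>) :: complex"
  let ?E = "\<lambda>\<theta>. r * exp (2 * pi * \<i> * of_real \<theta>) :: complex"
  have qd: "quad (z t) w = w\<^sup>2 - 2 * of_real (a + c * t) * w + of_real (s + 2 * b * t + d * t\<^sup>2)" for t w
    by (simp only: quad_alt re nm)
  have nz: "quad (z t) (?W k \<theta>) \<noteq> 0" if "k \<in> {z 0, cnj (z 0)}" "t \<in> ball 0 e" for k t \<theta>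
  proof (rule quad_nz_circle [OF R(2) r _ that(1)])
    show "z t \<in> ball (z 0) r" using that(2) zU by blast
  qed (use r in \<open>simp add: norm_mult\<close>)
  have der: "((\<lambda>t. circ k r (\<lambda>w. \<psi> w / quad (z t) w ^ Suc q)) has_vector_derivative
      of_nat (Suc q) * circ k r (\<lambda>w. (2 * c * w + (- 2 * b)) * \<psi> w / quad (z 0) w ^ Suc (Suc q))) (at 0)"
    if k: "k \<in> {z 0, cnj (z 0)}" for k
  proof -
    let ?f = "\<lambda>t \<theta>. \<psi> (?W k \<theta>) / quad (z t) (?W k \<theta>) ^ Suc q * ?E \<theta>"
    \<comment> \<open>For fixed \<open>w\<close>, \<open>quad (z t) w\<close> is quadratic in
      \<open>t\<close>, and the first factor is minus its derivative. The term with \<open>d\<close>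
      disappears at \<open>t = 0\<close>.\<close>
    let ?f' = "\<lambda>t \<theta>. of_nat (Suc q) * ((2 * c * ?W k \<theta> + (- 2 * b - 2 * d * t)) * \<psi> (?W k \<theta>) / quad (z t) (?W k \<theta>) ^ Suc (Suc q) * ?E \<theta>)"
    have "((\<lambda>t. integral (cbox 0 1) (?f t)) has_vector_derivative integral (cbox 0 1) (?f' 0)) (at 0 within ball 0 e)"
    proof (rule leibniz_rule_vector_derivative)
      fix t \<theta> :: real assume t: "t \<in> ball 0 e"
      let ?w = "?W k \<theta>"
      have "((\<lambda>t. quad (z t) ?w) has_vector_derivative (- (2 * c * ?w + (- 2 * b - 2 * d * t)))) (at t)"
        unfolding qd by (auto intro!: derivative_eq_intros simp: has_vector_derivative_def algebra_simps scaleR_conv_of_real)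
      then have "((\<lambda>t. ?f t \<theta>) has_vector_derivative ?f' t \<theta>) (at t)"
        by (rule has_vector_derivative_quotient_power) (rule nz [OF k t])
      then show "((\<lambda>t. ?f t \<theta>) has_vector_derivative ?f' t \<theta>) (at t within ball 0 e)"
        by (rule has_vector_derivative_at_within)
    next
      fix t :: real assume t: "t \<in> ball 0 e"
      have "continuous_on (ball 0 e \<times> cbox 0 1) (\<lambda>(x, \<theta>). ?f x \<theta>)"
        using continuous_circle_integrand [OF R(2) r k hol czU zU, of "\<lambda>_. 0" "\<lambda>_. 1" "Suc q"]
        by (simp add: Let_def del: power_Suc)
      then have "continuous_on (cbox 0 1) (\<lambda>\<theta>. (\<lambda>(x, \<theta>). ?f x \<theta>) (t, \<theta>))"
        by (rule continuous_on_compose2) (use t in \<open>auto intro!: continuous_intros\<close>)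
      then show "?f t integrable_on cbox 0 1"
        by (intro integrable_continuous) simp
    next
      have "continuous_on (ball 0 e) (\<lambda>t. complex_of_real (- 2 * b - 2 * d * t))"
        by (intro continuous_intros)
      from continuous_circle_integrand [OF R(2) r k hol czU zU _ this, of "\<lambda>_. 2 * c" "Suc (Suc q)"]
      have "continuous_on (ball 0 e \<times> cbox 0 1) (\<lambda>(t, \<theta>). (2 * c * ?W k \<theta> + (- 2 * b - 2 * d * t)) * \<psi> (?W k \<theta>) / quad (z t) (?W k \<theta>) ^ Suc (Suc q) * ?E \<theta>)"
        by (simp add: Let_def del: power_Suc)
      from continuous_on_mult_left [OF this, of "of_nat (Suc q)"]
      show "continuous_on (ball 0 e \<times> cbox 0 1) (\<lambda>(t, \<theta>). ?f' t \<theta>)"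
        by (simp add: case_prod_unfold del: power_Suc of_nat_Suc)
    qed (use e in auto)
    then have *: "((\<lambda>t. integral (cbox 0 1) (?f t)) has_vector_derivative integral (cbox 0 1) (?f' 0)) (at 0)"
      using e by (simp add: at_within_open [of _ "ball 0 e"] del: power_Suc of_nat_Suc)
    have eq: "of_nat (Suc q) * circ k r (\<lambda>w. (2 * c * w + (- 2 * b)) * \<psi> w / quad (z 0) w ^ Suc (Suc q))
        = integral (cbox 0 1) (?f' 0)"
      unfolding circ_integral integral_mult_right by simp
    show ?thesis unfolding eq unfolding circ_integral by (rule *)
  qed
  have hw: "(\<lambda>w. (2 * c * w + (- 2 * b)) * \<psi> w) holomorphic_on D"
    using hol by (intro holomorphic_intros)
  have "((\<lambda>t. \<Sum>k\<in>{z 0, cnj (z 0)}. circ k r (\<lambda>w. \<psi> w / quad (z t) w ^ Suc q)) has_vector_derivative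
      (\<Sum>k\<in>{z 0, cnj (z 0)}. of_nat (Suc q) * circ k r (\<lambda>w. (2 * c * w + (- 2 * b)) * \<psi> w / quad (z 0) w ^ Suc (Suc q)))) (at 0)"
    by (intro has_vector_derivative_sum der)
  also have "(\<Sum>k\<in>{z 0, cnj (z 0)}. of_nat (Suc q) * circ k r (\<lambda>w. (2 * c * w + (- 2 * b)) * \<psi> w / quad (z 0) w ^ Suc (Suc q)))
     = of_nat (Suc q) * dd (Suc q) (\<lambda>w. (2 * c * w + (- 2 * b)) * \<psi> w) (z 0)"
    using r by (subst dd_circ [OF R(2) r _ hw]) (simp_all add: sum_distrib_left del: power_Suc of_nat_Suc)
  also have "dd (Suc q) (\<lambda>w. (2 * c * w + (- 2 * b)) * \<psi> w) (z 0)
      = dd (Suc q) (\<lambda>w. (2 * c) * (w * \<psi> w) + (- 2 * b) * \<psi> w) (z 0)"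
    by (simp add: algebra_simps)
  also have "\<dots> = of_real (2 * c) * dd (Suc q) (\<lambda>w. w * \<psi> w) (z 0) - of_real (2 * b) * dd (Suc q) \<psi> (z 0)"
    using hol z0 by (subst dd_lincomb) (auto intro!: holomorphic_intros)
  finally have "((\<lambda>t. \<Sum>k\<in>{z 0, cnj (z 0)}. circ k r (\<lambda>w. \<psi> w / quad (z t) w ^ Suc q)) has_vector_derivative
      of_nat (Suc q) * (of_real (2 * c) * dd (Suc q) (\<lambda>w. w * \<psi> w) (z 0) - of_real (2 * b) * dd (Suc q) \<psi> (z 0))) (at 0)" .
  then show ?thesis
  proof (rule has_vector_derivative_transform_within_open [of _ _ _ "ball 0 e"])
    fix t :: real assume "t \<in> ball 0 e"
    then show "(\<Sum>k\<in>{z 0, cnj (z 0)}. circ k r (\<lambda>w. \<psi> w / quad (z t) w ^ Suc q)) = dd q \<psi> (z t)"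
      using zU by (intro dd_circ [OF R(2) r _ hol, symmetric]) blast
  qed (use e in auto)
qed

section \<open>Identities that raise the exponent, and recovery of a function from its residue
  sums\<close>

lemma dd_Suc_expand:
  assumes "\<psi> holomorphic_on D" "z \<in> D"
  shows "dd q \<psi> z = dd (Suc q) (\<lambda>w. w * (w * \<psi> w)) z - 2 * of_real (Re z) * dd (Suc q) (\<lambda>w. w * \<psi> w) z
     + of_real ((cmod z)\<^sup>2) * dd (Suc q) \<psi> z"
proof -
  have h: "(\<lambda>w. w * \<psi> w) holomorphic_on D" "(\<lambda>w. w * (w * \<psi> w)) holomorphic_on D"
    by (intro holomorphic_on_mult holomorphic_on_ident assms)+
  \<comment> \<open>By \<open>dd_quad\<close>, raising the exponent costs a factor
    \<open>quad z w\<close>, which is expanded as a polynomial in \<open>w\<close>. The nesting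
    matches two applications of \<open>dd_lincomb\<close>.\<close>
  have split: "(\<lambda>w. quad z w * \<psi> w)
     = (\<lambda>w. 1 * (1 * (w * (w * \<psi> w)) + (- 2 * of_real (Re z)) * (w * \<psi> w)) + of_real ((cmod z)\<^sup>2) * \<psi> w)"
    by (simp add: quad_alt algebra_simps power2_eq_square [of w for w :: complex])
  have inner: "(\<lambda>w. 1 * (w * (w * \<psi> w)) + (- 2 * of_real (Re z)) * (w * \<psi> w)) holomorphic_on D"
    by (intro holomorphic_on_add holomorphic_on_mult holomorphic_on_const holomorphic_on_ident assms(1))
  show ?thesis
    unfolding dd_quad [OF assms, of q, symmetric] split dd_lincomb [OF inner assms] dd_lincomb [OF h(2,1) assms(2)]
    by simp
qed

text \<open>With \<open>?A\<close> and \<open>?B\<close> as in the proof,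
  \<open>dd_total_derivative\<close> for \<open>w ^ Suc q * \<kappa> w\<close> gives
  \<open>2 * ?A - 2 * Re z * ?B\<close> for the sum of the terms \<open>dd q\<close> of
  \<open>w ^ q * \<kappa> w\<close> and \<open>w ^ Suc q * k w\<close>; the normalization of
  \<open>\<kappa>\<close> makes the factor \<open>Suc q\<close> common to all terms. Expanding the
  first summand by \<open>dd_Suc_expand\<close> cancels \<open>?B\<close>.\<close>

lemma dd_power_factor:
  fixes k \<kappa> :: "complex \<Rightarrow> complex"
  assumes k: "k holomorphic_on D" and \<kappa>: "\<And>w. w \<in> D \<Longrightarrow> (\<kappa> has_field_derivative (of_nat (Suc q) * k w)) (at w)"
    and z: "z \<in> D"
  shows "dd q (\<lambda>w. w ^ Suc q * k w) z = dd (Suc q) (\<lambda>w. w * (w * (w ^ q * \<kappa> w))) z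
     - of_real ((cmod z)\<^sup>2) * dd (Suc q) (\<lambda>w. w ^ q * \<kappa> w) z"
proof -
  have h\<kappa>: "\<kappa> holomorphic_on D"
    unfolding holomorphic_on_open [OF open_D] using \<kappa> by blast
  have h: "(\<lambda>w. w ^ q * \<kappa> w) holomorphic_on D" "(\<lambda>w. w ^ Suc q * k w) holomorphic_on D"
     "(\<lambda>w. w * (w ^ q * \<kappa> w)) holomorphic_on D" "(\<lambda>w. w * (w * (w ^ q * \<kappa> w))) holomorphic_on D"
    by (intro holomorphic_on_mult holomorphic_on_power holomorphic_on_ident h\<kappa> k)+
  let ?A = "dd (Suc q) (\<lambda>w. w * (w * (w ^ q * \<kappa> w))) z" and ?B = "dd (Suc q) (\<lambda>w. w * (w ^ q * \<kappa> w)) z"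
  let ?n = "of_nat (Suc q) :: complex"
  have total: "dd q (\<lambda>w. ?n * (w ^ q * \<kappa> w) + ?n * (w ^ Suc q * k w)) z
     = ?n * dd (Suc q) (\<lambda>w. 2 * (w - of_real (Re z)) * (w ^ Suc q * \<kappa> w)) z"
  proof (rule dd_total_derivative)
    fix w assume "w \<in> D"
    show "((\<lambda>w. w ^ Suc q * \<kappa> w) has_field_derivative
       (?n * (w ^ q * \<kappa> w) + ?n * (w ^ Suc q * k w))) (at w)"
      by (rule DERIV_cong [OF DERIV_mult [OF DERIV_power [OF DERIV_ident] \<kappa> [OF \<open>w \<in> D\<close>]]])
         (simp add: algebra_simps)
  qed (intro holomorphic_on_mult holomorphic_on_power holomorphic_on_ident h\<kappa>, rule z)
  have rearrange: "(\<lambda>w. 2 * (w - of_real (Re z)) * (w ^ Suc q * \<kappa> w))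
     = (\<lambda>w. 2 * (w * (w * (w ^ q * \<kappa> w))) + (- 2 * of_real (Re z)) * (w * (w ^ q * \<kappa> w)))"
    by (simp add: algebra_simps)
  have "dd q (\<lambda>w. ?n * (w ^ q * \<kappa> w) + ?n * (w ^ Suc q * k w)) z
     = ?n * dd (Suc q) (\<lambda>w. 2 * (w * (w * (w ^ q * \<kappa> w))) + (- 2 * of_real (Re z)) * (w * (w ^ q * \<kappa> w))) z"
    by (rule trans [OF total arg_cong [OF rearrange, where f = "\<lambda>f. ?n * dd (Suc q) f z"]])
  then have "?n * (dd q (\<lambda>w. w ^ q * \<kappa> w) z + dd q (\<lambda>w. w ^ Suc q * k w) z)
     = ?n * (2 * ?A + (- 2 * of_real (Re z)) * ?B)"
    unfolding dd_lincomb [OF h(1,2) z] dd_lincomb [OF h(4,3) z] distrib_left [of ?n] .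
  then have "dd q (\<lambda>w. w ^ q * \<kappa> w) z + dd q (\<lambda>w. w ^ Suc q * k w) z = 2 * ?A + (- 2 * of_real (Re z)) * ?B"
    by (simp only: mult_cancel_left of_nat_eq_0_iff) simp
  then show ?thesis
    unfolding dd_Suc_expand [OF h(1) z, of q] by (simp add: algebra_simps del: power_Suc)
qed

text \<open>The value at 0 is split off and the rest divided by \<open>w\<close>, repeatedly. The
  value \<open>deriv k 0\<close> removes the singularity of the difference quotient.\<close>

lemma holomorphic_factor:
  assumes "\<phi> holomorphic_on D"
  shows "\<exists>a k. k holomorphic_on D \<and> (\<forall>w\<in>D. \<phi> w = (\<Sum>d<n. a d * w ^ d) + w ^ n * k w)"
proof (induction n)
  case 0
  show ?case using assms by auto
next
  case (Suc n)
  then obtain a k where k: "k holomorphic_on D" "\<forall>w\<in>D. \<phi> w = (\<Sum>d<n. a d * w ^ d) + w ^ n * k w"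
    by blast
  define k' where "k' = (\<lambda>w. if w = 0 then deriv k 0 else (k w - k 0) / (w - 0))"
  have "k' holomorphic_on D"
    unfolding k'_def using pole_lemma_open [OF k(1) open_D] .
  moreover have "k w = k 0 + w * k' w" for w by (simp add: k'_def)
  then have "\<phi> w = (\<Sum>d<Suc n. (a(n := k 0)) d * w ^ d) + w ^ Suc n * k' w" if "w \<in> D" for w
  proof -
    have "(\<Sum>d<Suc n. (a(n := k 0)) d * w ^ d) = (\<Sum>d<n. a d * w ^ d) + k 0 * w ^ n"
      by simp
    moreover have "w ^ n * k w = k 0 * w ^ n + w ^ Suc n * k' w"
      by (subst \<open>\<And>w. k w = k 0 + w * k' w\<close>) (simp add: algebra_simps)
    ultimately show ?thesis using k(2) that by simp
  qed
  ultimately show ?case by blast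
qed

text \<open>Since \<open>(w - cnj z) / quad z w = 1 / (w - z)\<close>, this is Cauchy's integral
  formula on the circle about \<open>z\<close>; a separate circle about \<open>cnj z\<close>
  contributes nothing.\<close>

lemma dd_0_Cauchy:
  assumes hol: "\<phi> holomorphic_on D" and z: "z \<in> D"
  shows "dd 0 (\<lambda>w. w * \<phi> w) z - cnj z * dd 0 \<phi> z = \<phi> z"
proof -
  from z obtain r where r: "r > 0" "\<And>c. c \<in> {z, cnj z} \<Longrightarrow> cball c r \<subseteq> D"
    "\<And>c w. c \<in> {z, cnj z} \<Longrightarrow> cmod (w - c) = r \<Longrightarrow> w \<in> D \<and> quad z w \<noteq> 0"
    "z \<noteq> cnj z \<Longrightarrow> 2 * r \<le> dist z (cnj z)"
    "\<And>q \<psi>. \<psi> holomorphic_on D \<Longrightarrow>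
       dd q \<psi> z = (\<Sum>c\<in>{z, cnj z}. circ c r (\<lambda>w. \<psi> w / quad z w ^ Suc q))"
    by (rule dd_eval) blast
  have h: "(\<lambda>w. w * \<phi> w) holomorphic_on D" using hol by (intro holomorphic_intros)
  have "dd 0 (\<lambda>w. w * \<phi> w) z - cnj z * dd 0 \<phi> z = dd 0 (\<lambda>w. 1 * (w * \<phi> w) + (- cnj z) * \<phi> w) z"
    by (subst dd_lincomb [OF h hol z]) simp
  also have "\<dots> = (\<Sum>c\<in>{z, cnj z}. circ c r (\<lambda>w. (1 * (w * \<phi> w) + (- cnj z) * \<phi> w) / quad z w ^ Suc 0))"
    using hol h by (intro r(5) holomorphic_intros)
  also have "\<dots> = (\<Sum>c\<in>{z, cnj z}. circ c r (\<lambda>w. \<phi> w / (w - z)))"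
  proof (intro sum.cong refl circ_cong [OF r(1)])
    fix c w assume "c \<in> {z, cnj z}" "cmod (w - c) = r"
    then have "quad z w \<noteq> 0" using r by blast
    then have "w - cnj z \<noteq> 0" by (simp add: quad_def)
    then have "\<phi> w * (w - cnj z) / ((w - z) * (w - cnj z)) = \<phi> w / (w - z)"
      by (rule nonzero_mult_divide_mult_cancel_right)
    moreover have "1 * (w * \<phi> w) + (- cnj z) * \<phi> w = \<phi> w * (w - cnj z)"
      by (simp add: algebra_simps)
    ultimately show "(1 * (w * \<phi> w) + (- cnj z) * \<phi> w) / quad z w ^ Suc 0 = \<phi> w / (w - z)"
      by (simp only: quad_def power_Suc0_right)
  qed
  also have "\<dots> = (\<Sum>c\<in>{z, cnj z}. if c = z then \<phi> z else 0)"
  proof (intro sum.cong refl)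
    fix c assume c: "c \<in> {z, cnj z}"
    have hc: "\<phi> holomorphic_on cball c r" by (rule holomorphic_on_subset [OF hol r(2) [OF c]])
    show "circ c r (\<lambda>w. \<phi> w / (w - z)) = (if c = z then \<phi> z else 0)"
    proof (cases "c = z")
      case True
      then have "((\<lambda>w. \<phi> w / (w - z)) has_contour_integral (2 * of_real pi * \<i> * \<phi> z)) (circlepath c r)"
        using hc r(1) by (intro Cauchy_integral_circlepath_simple) auto
      then show ?thesis using True by (simp add: circ_def contour_integral_unique)
    next
      case False
      then have "dist z c \<ge> 2 * r" using c r(4) by auto
      then have "z \<notin> cball c r" using r(1) by (auto simp: dist_commute)
      then have "((\<lambda>w. \<phi> w / (w - z)) has_contour_integral 0) (circlepath c r)"
        using r(1) by (intro Cauchy_theorem_convex_simple [where S = "cball c r"] holomorphic_intros hc) auto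
      then show ?thesis using False by (simp add: circ_def contour_integral_unique)
    qed
  qed
  also have "\<dots> = \<phi> z" by (cases "z = cnj z") auto
  finally show ?thesis .
qed

text \<open>The Cauchy formulas at \<open>z\<close> and \<open>cnj z\<close> involve the same values
  of \<open>dd\<close>; their sum and difference isolate the two parts. The result has the shape of
  the stem of \<open>dd 0 (w \<phi>) - star x * dd 0 \<phi>\<close>.\<close>

lemma dd_0_Re_Im:
  assumes hol: "\<phi> holomorphic_on D" and z: "z \<in> D" and sym: "\<phi> (cnj z) = cnj (\<phi> z)"
  shows "Re (\<phi> z) = Re (dd 0 (\<lambda>w. w * \<phi> w) z) - Re z * Re (dd 0 \<phi> z)"
    and "Im (\<phi> z) = Im z * Re (dd 0 \<phi> z)"
proof -
  let ?P = "dd 0 (\<lambda>w. w * \<phi> w) z" and ?B = "dd 0 \<phi> z"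
  have 1: "?P - cnj z * ?B = \<phi> z"
    using dd_0_Cauchy [OF hol z] .
  have 2: "?P - z * ?B = cnj (\<phi> z)"
    using dd_0_Cauchy [OF hol cnj_D [OF z]] by (simp add: dd_cnj sym)
  have "\<phi> z + cnj (\<phi> z) = 2 * ?P - (z + cnj z) * ?B"
    using 1 2 by (simp add: algebra_simps)
  then have "Re (\<phi> z + cnj (\<phi> z)) = Re (2 * ?P - (z + cnj z) * ?B)" by simp
  then show "Re (\<phi> z) = Re ?P - Re z * Re ?B" by simp
  have "\<phi> z - cnj (\<phi> z) = (z - cnj z) * ?B"
    using 1 2 by (simp add: algebra_simps)
  then have "Im (\<phi> z - cnj (\<phi> z)) = Im ((z - cnj z) * ?B)" by simp
  then show "Im (\<phi> z) = Im z * Re ?B" by simp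
qed

end

text \<open>On the whole plane, circles about 0 of arbitrarily large radius are valid contours,
  which allows estimates at infinity.\<close>

interpretation entire: cnj_domain UNIV
  by unfold_locales auto

text \<open>On a large circle of radius \<open>r\<close> the integrand is of order at most
  \<open>1 / r ^ 2\<close>, so the integral tends to zero, while its value does not depend on
  \<open>r\<close>.\<close>

lemma dd_monomial:
  assumes "d \<le> 2 * q"
  shows "dd q (\<lambda>w. w ^ d) z = 0"
proof -
  \<comment> \<open>This constant comes from the lower bound \<open>(r / 2) ^ 2\<close> for
    \<open>|quad z w|\<close>, raised to the power \<open>Suc q\<close>.\<close>
  define C where "C = (2::real) ^ (2 * Suc q)"
  have bound: "cmod (dd q (\<lambda>w. w ^ d) z) \<le> C / r" if r: "r \<ge> 2 * cmod z + 1" for r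
  proof -
    have r1: "r \<ge> 1" "r > cmod z" "r - cmod z \<ge> r / 2" using r norm_ge_zero [of z] by linarith+
    let ?g = "\<lambda>w. w ^ d / quad z w ^ Suc q"
    have eq: "dd q (\<lambda>w. w ^ d) z = circ 0 r ?g"
      by (subst entire.dd_circ [of 0 "r + 1" r]) (use r1 in \<open>auto simp: isolating_def intro!: holomorphic_intros\<close>)
    have qb: "(r / 2)\<^sup>2 \<le> cmod (quad z w)" if "cmod w = r" for w
    proof -
      have "r / 2 \<le> cmod (w - z)" "r / 2 \<le> cmod (w - cnj z)"
        using norm_triangle_ineq2 [of w z] norm_triangle_ineq2 [of w "cnj z"] that r1 by simp_all
      then show ?thesis
        unfolding quad_def norm_mult power2_eq_square using r1 by (intro mult_mono) auto
    qed
    have gb: "cmod (?g w) \<le> C / r\<^sup>2" if "cmod w = r" for w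
    proof -
      have pos: "0 < (r / 2)\<^sup>2" using r1 by simp
      have "cmod (?g w) = r ^ d / cmod (quad z w) ^ Suc q"
        using that by (simp only: norm_divide norm_power)
      also have "\<dots> \<le> r ^ d / ((r / 2)\<^sup>2) ^ Suc q"
        using qb [OF that] pos r1 by (intro divide_left_mono power_mono mult_pos_pos zero_less_power) auto
      also have "\<dots> = C * r ^ d / r ^ (2 * Suc q)"
        by (simp only: C_def power_mult [symmetric] power_divide) simp
      also have "\<dots> \<le> C * r ^ (2 * q) / r ^ (2 * Suc q)"
        using r1 assms by (intro divide_right_mono mult_left_mono power_increasing) (auto simp: C_def)
      also have "\<dots> = C / r\<^sup>2"
        using r1 by (simp add: power2_eq_square field_simps)
      finally show ?thesis .
    qed
    have "?g contour_integrable_on circlepath 0 r"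
      using qb r1 by (intro contour_integrable_circ entire.continuous_quotient holomorphic_intros) force+
    then have "(?g has_contour_integral (contour_integral (circlepath 0 r) ?g)) (circlepath 0 r)"
      by (rule has_contour_integral_integral)
    then have "cmod (contour_integral (circlepath 0 r) ?g) \<le> C / r\<^sup>2 * (2 * pi * r)"
      by (rule has_contour_integral_bound_circlepath) (use gb r1 in \<open>auto simp: C_def\<close>)
    then have "cmod (contour_integral (circlepath 0 r) ?g) / (2 * pi) \<le> C / r\<^sup>2 * (2 * pi * r) / (2 * pi)"
      by (rule divide_right_mono) simp
    moreover have "cmod (circ 0 r ?g) = cmod (contour_integral (circlepath 0 r) ?g) / (2 * pi)"
      by (simp add: circ_def norm_divide norm_mult)
    ultimately have "cmod (circ 0 r ?g) \<le> C / r\<^sup>2 * (2 * pi * r) / (2 * pi)"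
      by linarith
    also have "\<dots> = C / r" using r1 by (simp add: power2_eq_square)
    finally show ?thesis by (simp only: eq)
  qed
  have "((\<lambda>r. C / r) \<longlongrightarrow> 0) at_top"
    by real_asymp
  moreover have "eventually (\<lambda>r. cmod (dd q (\<lambda>w. w ^ d) z) \<le> C / r) at_top"
    using eventually_ge_at_top [of "2 * cmod z + 1"] by eventually_elim (rule bound)
  ultimately have "cmod (dd q (\<lambda>w. w ^ d) z) \<le> 0"
    by (intro tendsto_lowerbound [of "\<lambda>r. C / r" 0 at_top]) auto
  then show ?thesis by simp
qed

section \<open>Expansion in powers of \<open>|z| ^ 2\<close> on star-like domains\<close>

locale star_cnj_domain = cnj_domain +
  assumes star_D: "z \<in> D \<Longrightarrow> closed_segment 0 z \<subseteq> D" and zero_D: "0 \<in> D"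
begin

text \<open>The polynomial part of degree at most \<open>q\<close> is killed by
  \<open>dd_monomial\<close>, and \<open>dd_power_factor\<close> treats the rest with the primitive
  \<open>\<kappa>\<close> that the star-like domain provides.\<close>

lemma dd_raise:
  assumes hol: "\<phi> holomorphic_on D"
  shows "\<exists>\<psi>0 \<psi>1. \<psi>0 holomorphic_on D \<and> \<psi>1 holomorphic_on D \<and>
    (\<forall>z\<in>D. dd q \<phi> z = dd (Suc q) \<psi>0 z + of_real ((cmod z)\<^sup>2) * dd (Suc q) \<psi>1 z)"
proof -
  obtain a k where k: "k holomorphic_on D" "\<forall>w\<in>D. \<phi> w = (\<Sum>d<Suc q. a d * w ^ d) + w ^ Suc q * k w"
    using holomorphic_factor [OF hol] by blast
  have "starlike D" using star_D zero_D by (auto simp: starlike_def)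
  moreover have hk: "(\<lambda>w. of_nat (Suc q) * k w) holomorphic_on D"
    using k by (intro holomorphic_intros)
  ultimately obtain \<kappa> where \<kappa>: "\<And>w. w \<in> D \<Longrightarrow> (\<kappa> has_field_derivative (of_nat (Suc q) * k w)) (at w)"
    using holomorphic_starlike_primitive [OF holomorphic_on_imp_continuous_on [OF hk] _ open_D finite.emptyI]
      holomorphic_on_imp_differentiable_at [OF hk open_D] by blast
  have h\<kappa>: "\<kappa> holomorphic_on D"
    unfolding holomorphic_on_open [OF open_D] using \<kappa> by blast
  have poly: "dd q (\<lambda>w. \<Sum>d<n. a d * w ^ d) z = 0" if "n \<le> Suc q" for n z
    using that
  proof (induction n)
    case 0
    show ?case using entire.dd_cmul [of "\<lambda>_. 0" z q 0] by simp
  next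
    case (Suc n)
    have "dd q (\<lambda>w. a n * w ^ n) z = a n * dd q (\<lambda>w. w ^ n) z"
      by (rule entire.dd_cmul) (auto intro!: holomorphic_intros)
    then have "dd q (\<lambda>w. (\<Sum>d<n. a d * w ^ d) + a n * w ^ n) z = 0"
      using Suc by (subst entire.dd_add) (auto intro!: holomorphic_intros simp: dd_monomial)
    then show ?case by simp
  qed
  have "dd q \<phi> z = dd (Suc q) (\<lambda>w. w * (w * (w ^ q * \<kappa> w))) z
     + of_real ((cmod z)\<^sup>2) * dd (Suc q) (\<lambda>w. (- 1) * (w ^ q * \<kappa> w)) z" if z: "z \<in> D" for z
  proof -
    have "dd q \<phi> z = dd q (\<lambda>w. (\<Sum>d<Suc q. a d * w ^ d) + w ^ Suc q * k w) z"
      using k z hol by (intro dd_cong) auto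
    also have "\<dots> = dd q (\<lambda>w. w ^ Suc q * k w) z"
      using k z by (subst dd_add) (auto intro!: holomorphic_intros simp: poly simp del: power_Suc sum.lessThan_Suc)
    also have "\<dots> = dd (Suc q) (\<lambda>w. w * (w * (w ^ q * \<kappa> w))) z
       - of_real ((cmod z)\<^sup>2) * dd (Suc q) (\<lambda>w. w ^ q * \<kappa> w) z"
      by (rule dd_power_factor [OF k(1) \<kappa> z])
    finally show ?thesis
      using h\<kappa> z by (subst dd_cmul) (auto intro!: holomorphic_intros)
  qed
  moreover have "(\<lambda>w. w * (w * (w ^ q * \<kappa> w))) holomorphic_on D" "(\<lambda>w. (- 1) * (w ^ q * \<kappa> w)) holomorphic_on D"
    by (intro holomorphic_on_mult holomorphic_on_power holomorphic_on_ident holomorphic_on_const h\<kappa>)+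
  ultimately show ?thesis by blast
qed

lemma dd_0_expansion:
  assumes hol: "\<phi> holomorphic_on D"
  shows "\<exists>\<psi>. (\<forall>k. \<psi> k holomorphic_on D) \<and>
    (\<forall>z\<in>D. dd 0 \<phi> z = (\<Sum>k\<le>n. of_real (cmod z ^ (2 * k)) * dd n (\<psi> k) z))"
proof (induction n)
  case 0
  show ?case using hol by (intro exI [of _ "\<lambda>_. \<phi>"]) simp
next
  case (Suc n)
  then obtain \<psi> where \<psi>: "\<And>k. \<psi> k holomorphic_on D"
    "\<And>z. z \<in> D \<Longrightarrow> dd 0 \<phi> z = (\<Sum>k\<le>n. of_real (cmod z ^ (2 * k)) * dd n (\<psi> k) z)"
    by blast
  have "\<forall>k. \<exists>\<psi>0 \<psi>1. \<psi>0 holomorphic_on D \<and> \<psi>1 holomorphic_on D \<and>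
    (\<forall>z\<in>D. dd n (\<psi> k) z = dd (Suc n) \<psi>0 z + of_real ((cmod z)\<^sup>2) * dd (Suc n) \<psi>1 z)"
    using dd_raise \<psi>(1) by blast
  then obtain \<alpha> \<beta> where h: "\<And>k. \<alpha> k holomorphic_on D" "\<And>k. \<beta> k holomorphic_on D"
    "\<And>k z. z \<in> D \<Longrightarrow> dd n (\<psi> k) z = dd (Suc n) (\<alpha> k) z + of_real ((cmod z)\<^sup>2) * dd (Suc n) (\<beta> k) z"
    by metis
  \<comment> \<open>Raising the exponent spreads each coefficient over two neighbouring powers of
    \<open>|z| ^ 2\<close>, so the new coefficient \<open>k\<close> is \<open>\<alpha> k\<close>
    plus the shifted \<open>\<beta> (k - 1)\<close>. Zero functions fill the ends
    \<open>k = Suc n\<close> and \<open>k = 0\<close>.\<close>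
  define \<alpha>' where "\<alpha>' k = (if k \<le> n then \<alpha> k else (\<lambda>_. 0))" for k
  define \<beta>' where "\<beta>' k = (case k of 0 \<Rightarrow> (\<lambda>_. 0) | Suc j \<Rightarrow> \<beta> j)" for k
  have h': "\<alpha>' k holomorphic_on D" "\<beta>' k holomorphic_on D" for k
    using h by (auto simp: \<alpha>'_def \<beta>'_def split: nat.split)
  have zero: "dd (Suc n) (\<lambda>_. 0) z = 0" for z
    using entire.dd_cmul [of "\<lambda>_. 0" z "Suc n" 0] by simp
  have "dd 0 \<phi> z = (\<Sum>k\<le>Suc n. of_real (cmod z ^ (2 * k)) * dd (Suc n) (\<lambda>w. \<alpha>' k w + \<beta>' k w) z)" if z: "z \<in> D" for z
  proof -
    let ?c = "\<lambda>k. complex_of_real (cmod z ^ (2 * k))"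
    have "(\<Sum>k\<le>Suc n. ?c k * dd (Suc n) (\<lambda>w. \<alpha>' k w + \<beta>' k w) z)
      = (\<Sum>k\<le>Suc n. ?c k * dd (Suc n) (\<alpha>' k) z) + (\<Sum>k\<le>Suc n. ?c k * dd (Suc n) (\<beta>' k) z)"
      using h' z by (simp only: dd_add distrib_left sum.distrib)
    also have "(\<Sum>k\<le>Suc n. ?c k * dd (Suc n) (\<alpha>' k) z) = (\<Sum>k\<le>n. ?c k * dd (Suc n) (\<alpha> k) z)"
      by (simp add: \<alpha>'_def zero)
    also have "(\<Sum>k\<le>Suc n. ?c k * dd (Suc n) (\<beta>' k) z) = (\<Sum>k\<le>n. ?c (Suc k) * dd (Suc n) (\<beta> k) z)"
      by (subst sum.atMost_Suc_shift) (simp add: \<beta>'_def zero)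
    finally show ?thesis
      using z by (simp add: \<psi>(2) h(3) sum.distrib [symmetric] algebra_simps power2_eq_square)
  qed
  moreover have "(\<lambda>w. \<alpha>' k w + \<beta>' k w) holomorphic_on D" for k
    using h' by (intro holomorphic_intros)
  ultimately show ?case
    by (intro exI [of _ "\<lambda>k w. \<alpha>' k w + \<beta>' k w"]) blast
qed

end

section \<open>Alternative star-algebras and hypercomplex subspaces\<close>

text \<open>Bilinear maps in finite dimension are bounded. This gives the distributive laws and the
  product rule for a multiplication that need not be associative.\<close>

lemma bounded_bilinear_alg_mult: "bounded_bilinear ((*) :: 'a \<Rightarrow> 'a \<Rightarrow> 'a::alternative_star_algebra)"
  unfolding bilinear_conv_bounded_bilinear [symmetric] bilinear_def
  by (auto intro!: linearI simp: mult_add_left mult_add_right mult_scaleR_left mult_scaleR_right)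

interpretation alg: bounded_bilinear "(*) :: 'a \<Rightarrow> 'a \<Rightarrow> 'a::alternative_star_algebra"
  by (rule bounded_bilinear_alg_mult)

lemma bounded_linear_star: "bounded_linear (star :: 'a \<Rightarrow> 'a::alternative_star_algebra)"
  unfolding linear_conv_bounded_linear [symmetric] by (auto intro!: linearI simp: star_add star_scaleR)

lemmas star_minus = linear_neg [OF bounded_linear.linear [OF bounded_linear_star]]
lemmas star_sum = linear_sum [OF bounded_linear.linear [OF bounded_linear_star]]

lemma star_one: "star (1 :: 'a::alternative_star_algebra) = 1"
  using star_real [of 1] by simp

lemma left_alternative: "x * (x * y) = (x * x) * (y :: 'a::alternative_star_algebra)"
  using associator_left [of x y] by (simp add: associator_def)

text \<open>The coefficient of the projection onto 1 for the auxiliary inner product: linear on the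
  whole algebra, and equal to \<open>real_value\<close> on \<open>span {1}\<close>.\<close>

definition scalar_part :: "'a::alternative_star_algebra \<Rightarrow> real" where
  "scalar_part y = inner y 1 / inner 1 (1 :: 'a)"

lemma bounded_linear_scalar_part: "bounded_linear (scalar_part :: 'a::alternative_star_algebra \<Rightarrow> real)"
  unfolding scalar_part_def [abs_def]
  by (intro bounded_linear_compose [OF bounded_linear_divide] bounded_linear_inner_left)

lemmas scalar_part_add = linear_add [OF bounded_linear.linear [OF bounded_linear_scalar_part]]
lemmas scalar_part_scaleR = linear_scale [OF bounded_linear.linear [OF bounded_linear_scalar_part]]

lemma scalar_part_one: "scalar_part (1 :: 'a::alternative_star_algebra) = 1"
  by (simp add: scalar_part_def one_neq_zero)

lemma scalar_part_of_real: "scalar_part (r *\<^sub>R (1 :: 'a::alternative_star_algebra)) = r"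
  by (simp add: scalar_part_scaleR scalar_part_one)

lemma scaleR_scalar_part: "y \<in> span {1} \<Longrightarrow> scalar_part y *\<^sub>R 1 = (y :: 'a::alternative_star_algebra)"
  by (auto simp: span_singleton scalar_part_of_real)

lemma real_value_of_real: "real_value (r *\<^sub>R (1 :: 'a::alternative_star_algebra)) = r"
  unfolding real_value_def by (rule the_equality) (auto simp: one_neq_zero)

text \<open>
  A bilinear extension of the scalar product to the whole algebra; outside of a hypercomplex subspace
  \<open>real_value\<close> may be applied off its domain.
\<close>

definition form :: "'a::alternative_star_algebra \<Rightarrow> 'a \<Rightarrow> real" where
  "form x y = scalar_part ((1/2) *\<^sub>R (x * star y + y * star x))"

lemma bounded_bilinear_form: "bounded_bilinear (form :: 'a::alternative_star_algebra \<Rightarrow> _)"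
  unfolding bilinear_conv_bounded_bilinear [symmetric] bilinear_def form_def
  by (auto intro!: linearI simp: alg.add_left alg.add_right alg.scaleR_left alg.scaleR_right
      star_add star_scaleR scalar_part_add scalar_part_scaleR add_divide_distrib algebra_simps)

interpretation form_bl: bounded_bilinear "form :: 'a::alternative_star_algebra \<Rightarrow> _"
  by (rule bounded_bilinear_form)

lemma form_commute: "form x y = form y (x :: 'a::alternative_star_algebra)"
  by (simp add: form_def add.commute)

lemma imag_unitsD:
  assumes "J \<in> imag_units"
  shows "star J = - J" and "J * J = - (1 :: 'a::alternative_star_algebra)"
proof -
  show s: "star J = - J"
    using assms by (simp add: imag_units_def alg_trace_def eq_neg_iff_add_eq_0 add.commute)
  have "- (J * J) = 1"
    using assms by (simp add: imag_units_def alg_norm_def s alg.minus_right)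
  then show "J * J = - 1" by (metis minus_minus)
qed

lemma minus_imag_units: "J \<in> imag_units \<Longrightarrow> - J \<in> (imag_units :: 'a::alternative_star_algebra set)"
  by (simp add: imag_units_def alg_trace_def alg_norm_def star_minus alg.minus_left alg.minus_right)
    (simp add: add_eq_0_iff)

lemma imag_units_left_mult_mult: "J \<in> imag_units \<Longrightarrow> J * (J * y) = - (y :: 'a::alternative_star_algebra)"
  by (simp add: left_alternative imag_unitsD alg.minus_left mult_one_left)

lemma complex_slice:
  fixes J :: "'a::alternative_star_algebra"
  assumes J: "J \<in> imag_units" and x: "x = a *\<^sub>R 1 + b *\<^sub>R J"
  shows "star x = a *\<^sub>R 1 - b *\<^sub>R J" and "x + star x = (2 * a) *\<^sub>R 1" and "x * star x = (a\<^sup>2 + b\<^sup>2) *\<^sub>R 1"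
    and "form x 1 = a" and "form x x = a\<^sup>2 + b\<^sup>2"
proof -
  show s: "star x = a *\<^sub>R 1 - b *\<^sub>R J"
    by (simp add: x star_add star_scaleR star_one imag_unitsD(1) [OF J])
  show t: "x + star x = (2 * a) *\<^sub>R 1"
    unfolding s unfolding x by (simp add: scaleR_add_left [symmetric])
  show n: "x * star x = (a\<^sup>2 + b\<^sup>2) *\<^sub>R 1"
    unfolding s unfolding x
    by (simp add: alg.add_left alg.diff_right alg.scaleR_left alg.scaleR_right mult_one_left mult_one_right
        imag_unitsD(2) [OF J] scaleR_add_left scaleR_add_right scaleR_diff_right power2_eq_square mult.commute)
  show "form x 1 = a"
    using t by (simp add: form_def star_one mult_one_left mult_one_right scalar_part_of_real)
  show "form x x = a\<^sup>2 + b\<^sup>2"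
    by (simp add: form_def n scaleR_add_left [symmetric] scalar_part_of_real)
qed

text \<open>For an imaginary unit \<open>J\<close>, \<open>a + b J\<close> is sent to its
  representative \<open>a + i |b|\<close> in the closed upper half-plane. The expression through
  \<open>form\<close> makes continuity evident on the whole algebra.\<close>

definition slice_coord :: "'a::alternative_star_algebra \<Rightarrow> complex" where
  "slice_coord x = Complex (form x 1) (sqrt (form x x - (form x 1)\<^sup>2))"

lemma continuous_on_slice_coord: "continuous_on UNIV (slice_coord :: 'a::alternative_star_algebra \<Rightarrow> _)"
  unfolding slice_coord_def [abs_def]
  by (intro continuous_intros continuous_on_Complex form_bl.continuous_on)

lemma slice_coord_slice:
  fixes J :: "'a::alternative_star_algebra"
  assumes "J \<in> imag_units"
  shows "slice_coord (a *\<^sub>R 1 + b *\<^sub>R J) = Complex a \<bar>b\<bar>"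
  by (simp add: slice_coord_def complex_slice(4,5) [OF assms refl])

lemma slice_coord_cases:
  fixes J :: "'a::alternative_star_algebra"
  assumes "J \<in> imag_units"
  shows "slice_coord (Re z *\<^sub>R 1 + Im z *\<^sub>R J) \<in> {z, cnj z}"
  by (simp add: slice_coord_slice [OF assms] complex_eq_iff abs_if)

section \<open>Hypercomplex subspaces and orthonormal coordinates\<close>

locale hypercomplex =
  fixes M :: "'a::alternative_star_algebra set" and m :: nat and v :: "nat \<Rightarrow> 'a"
  assumes M: "hypercomplex_subspace M" and v: "orthonormal_basis M m v"
begin

lemma subspace_M: "subspace M"
  using M by (simp add: hypercomplex_subspace_def)

lemma one_in_M: "1 \<in> M"
  using M span_base [of 1 "{1}"] by (auto simp: hypercomplex_subspace_def)

lemma slice_representation: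
  assumes "x \<in> M"
  obtains a b J where "J \<in> imag_units" "x = a *\<^sub>R 1 + b *\<^sub>R J"
proof -
  obtain J where J: "J \<in> imag_units" "x \<in> span {1, J}"
    using assms M by (auto simp: hypercomplex_subspace_def quadratic_cone_def)
  then obtain a where "x - a *\<^sub>R 1 \<in> span {J}"
    using span_breakdown_eq by blast
  then obtain b where "x - a *\<^sub>R 1 = b *\<^sub>R J"
    by (auto simp: span_singleton)
  then have "x = a *\<^sub>R 1 + b *\<^sub>R J" by (simp add: algebra_simps)
  with J show ?thesis using that by blast
qed

lemma
  assumes "x \<in> M"
  shows star_M: "star x = (2 * form x 1) *\<^sub>R 1 - x"
    and mult_star_M: "x * star x = form x x *\<^sub>R 1"
    and Re_slice_coord: "Re (slice_coord x) = form x 1"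
    and cmod_slice_coord: "(cmod (slice_coord x))\<^sup>2 = form x x"
    and hc_norm_M: "hc_norm x = cmod (slice_coord x)"
proof -
  obtain a b J where *: "J \<in> imag_units" "x = a *\<^sub>R 1 + b *\<^sub>R J"
    using slice_representation [OF assms] .
  note cs = complex_slice [OF *]
  show "star x = (2 * form x 1) *\<^sub>R 1 - x"
    using cs(2,4) by (simp add: algebra_simps)
  show n: "x * star x = form x x *\<^sub>R 1"
    using cs(3,5) by simp
  show "Re (slice_coord x) = form x 1"
    by (simp add: slice_coord_def)
  show c: "(cmod (slice_coord x))\<^sup>2 = form x x"
    using slice_coord_slice [OF *(1), of a b] cs(5) *(2) by (simp add: cmod_power2)
  show "hc_norm x = cmod (slice_coord x)"
    unfolding hc_norm_def alg_norm_def n real_value_of_real c [symmetric] by simp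
qed

text \<open>As \<open>star x\<close> is a real number minus \<open>x\<close>, left alternativity
  does the work of associativity.\<close>

lemma left_mult_star_M:
  assumes "x \<in> M"
  shows "x * (star x * y) = form x x *\<^sub>R y"
proof -
  let ?t = "2 * form x 1"
  have "x * (star x * y) = ?t *\<^sub>R (x * y) - (x * x) * y"
    by (simp add: star_M [OF assms] alg.diff_left alg.diff_right alg.scaleR_left alg.scaleR_right
        mult_one_left left_alternative)
  also have "\<dots> = (x * (?t *\<^sub>R 1 - x)) * y"
    by (simp add: alg.diff_left alg.diff_right alg.scaleR_left alg.scaleR_right mult_one_right)
  also have "\<dots> = form x x *\<^sub>R y"
    by (simp add: star_M [OF assms, symmetric] mult_star_M [OF assms] alg.scaleR_left mult_one_left)
  finally show ?thesis .
qed

text \<open>Polarization of \<open>mult_star_M\<close>.\<close>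

lemma hc_inner_M:
  assumes "x \<in> M" "y \<in> M"
  shows "hc_inner x y = form x y"
proof -
  have xy: "x + y \<in> M" using assms subspace_M by (simp add: subspace_add)
  have "x * star y + y * star x = (x + y) * star (x + y) - x * star x - y * star y"
    by (simp add: alg.add_left alg.add_right star_add)
  also have "\<dots> = (form (x + y) (x + y) - form x x - form y y) *\<^sub>R 1"
    by (simp add: mult_star_M [OF xy] mult_star_M [OF assms(1)] mult_star_M [OF assms(2)] scaleR_diff_left)
  also have "form (x + y) (x + y) - form x x - form y y = 2 * form x y"
    by (simp add: form_bl.add_left form_bl.add_right form_commute [of y x])
  finally have "(1/2) *\<^sub>R (x * star y + y * star x) = form x y *\<^sub>R 1" by simp
  then show ?thesis
    by (simp only: hc_inner_def alg_trace_def star_mult star_involution real_value_of_real)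
qed

lemma v_0: "v 0 = 1" and v_M: "i \<le> m \<Longrightarrow> v i \<in> M" and span_v: "span (v ` {..m}) = M"
  using v by (auto simp: orthonormal_basis_def)

lemma form_v: "i \<le> m \<Longrightarrow> j \<le> m \<Longrightarrow> form (v i) (v j) = (if i = j then 1 else 0)"
  using v hc_inner_M [of "v i" "v j"] v_M by (simp add: orthonormal_basis_def)

lemma form_v_one: "i \<le> m \<Longrightarrow> form (v i) 1 = (if i = 0 then 1 else 0)"
  using form_v [of i 0] by (simp add: v_0)

lemma coordinates:
  assumes "x \<in> M"
  shows "(\<Sum>i\<le>m. form x (v i) *\<^sub>R v i) = x"
proof -
  have "inj_on v {..m}"
  proof (rule inj_onI)
    fix i j assume "i \<in> {..m}" "j \<in> {..m}" "v i = v j"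
    then show "i = j" using form_v [of i j] form_v [of i i] by (auto split: if_splits)
  qed
  moreover obtain u where "x = (\<Sum>w\<in>v ` {..m}. u w *\<^sub>R w)"
    using assms span_v span_finite [of "v ` {..m}"] by auto
  ultimately have x: "x = (\<Sum>i\<le>m. u (v i) *\<^sub>R v i)"
    by (simp add: sum.reindex)
  have "form x (v j) = u (v j)" if "j \<le> m" for j
    using that by (subst x) (simp add: form_bl.sum_left form_bl.scaleR_left form_v if_distrib cong: if_cong)
  then show ?thesis by (subst (2) x) simp
qed

lemma sum_coordinates_squared:
  assumes "x \<in> M"
  shows "(\<Sum>i\<le>m. (form x (v i))\<^sup>2) = form x x"
proof -
  have "form x x = form x (\<Sum>i\<le>m. form x (v i) *\<^sub>R v i)"
    by (simp add: coordinates [OF assms])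
  then show ?thesis
    by (simp add: form_bl.sum_right form_bl.scaleR_right power2_eq_square)
qed

lemma sum_left_mult_coordinates:
  assumes "x \<in> M"
  shows "(\<Sum>i\<le>m. form x (v i) *\<^sub>R (v i * y)) = x * y"
    and "(\<Sum>i\<le>m. form x (v i) *\<^sub>R (star (v i) * y)) = star x * y"
proof -
  have "x * y = (\<Sum>i\<le>m. form x (v i) *\<^sub>R v i) * y" by (simp add: coordinates [OF assms])
  then show "(\<Sum>i\<le>m. form x (v i) *\<^sub>R (v i * y)) = x * y"
    by (simp add: alg.sum_left alg.scaleR_left)
  have "star x * y = star (\<Sum>i\<le>m. form x (v i) *\<^sub>R v i) * y" by (simp add: coordinates [OF assms])
  then show "(\<Sum>i\<le>m. form x (v i) *\<^sub>R (star (v i) * y)) = star x * y"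
    by (simp add: alg.sum_left alg.scaleR_left star_sum star_scaleR)
qed

lemma v_imag_unit: "0 < i \<Longrightarrow> i \<le> m \<Longrightarrow> v i \<in> imag_units"
  using star_M [OF v_M, of i] mult_star_M [OF v_M, of i]
  by (simp add: imag_units_def alg_trace_def alg_norm_def form_v_one form_v)

text \<open>The symmetry of \<open>D\<close> makes the choice of the upper half-plane in
  \<open>slice_coord\<close> immaterial.\<close>

lemma mem_circularization_iff:
  assumes "x \<in> M" "\<And>z. z \<in> D \<Longrightarrow> cnj z \<in> D"
  shows "x \<in> circularization D \<longleftrightarrow> slice_coord x \<in> D"
proof
  assume "x \<in> circularization D"
  then obtain z J where "z \<in> D" "J \<in> imag_units" "x = Re z *\<^sub>R 1 + Im z *\<^sub>R J"
    by (auto simp: circularization_def)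
  then show "slice_coord x \<in> D"
    using slice_coord_cases [of J z] assms(2) by auto
next
  assume D: "slice_coord x \<in> D"
  obtain a b J where *: "J \<in> imag_units" "x = a *\<^sub>R 1 + b *\<^sub>R J"
    using slice_representation [OF assms(1)] .
  have "slice_coord x = Complex a \<bar>b\<bar>"
    using slice_coord_slice * by blast
  then have "Complex a b \<in> {slice_coord x, cnj (slice_coord x)}"
    by (auto simp: complex_eq_iff abs_if)
  then have "Complex a b \<in> D" using D assms(2) by auto
  then show "x \<in> circularization D"
    using * by (force simp: circularization_def)
qed

end

section \<open>Partial derivatives of axially symmetric functions\<close>

locale axial_domain = hypercomplex M m v + cnj_domain D
  for M :: "'a::alternative_star_algebra set" and m v and D +
  fixes \<Omega> E :: "'a set"
  assumes Omega: "\<Omega> = circularization D \<inter> M" and finite_E: "finite E"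
begin

lemma Omega_iff: "x \<in> \<Omega> \<longleftrightarrow> x \<in> M \<and> slice_coord x \<in> D"
  using mem_circularization_iff [OF _ cnj_D] by (auto simp: Omega)

lemma line_in_M: "x \<in> M \<Longrightarrow> i \<le> m \<Longrightarrow> x + t *\<^sub>R v i \<in> M"
  using subspace_M v_M by (simp add: subspace_add subspace_scale)

lemma continuous_on_line_slice_coord: "continuous_on UNIV (\<lambda>t::real. slice_coord (x + t *\<^sub>R v i))"
  by (rule continuous_on_compose2 [OF continuous_on_slice_coord]) (auto intro!: continuous_intros)

text \<open>Openness of \<open>D\<close> pulls back through the continuous
  \<open>slice_coord\<close>, so short segments in basis directions stay in
  \<open>\<Omega>\<close>.\<close>

lemma line_in_Omega:
  assumes "x \<in> \<Omega>" "i \<le> m"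
  obtains S where "open S" "(0::real) \<in> S" "\<And>t. t \<in> S \<Longrightarrow> x + t *\<^sub>R v i \<in> \<Omega>"
proof (rule that)
  let ?S = "(\<lambda>t::real. slice_coord (x + t *\<^sub>R v i)) -` D"
  show "open ?S"
    using open_vimage [OF open_D continuous_on_line_slice_coord] .
  show "0 \<in> ?S" using assms by (simp add: Omega_iff)
  show "x + t *\<^sub>R v i \<in> \<Omega>" if "t \<in> ?S" for t
    using that assms line_in_M by (simp add: Omega_iff)
qed

section \<open>Calculus of partial derivatives on \<open>\<Omega>\<close>\<close>

definition has_partial :: "nat \<Rightarrow> ('a \<Rightarrow> 'a) \<Rightarrow> ('a \<Rightarrow> 'a) \<Rightarrow> bool" where
  "has_partial i f f' \<longleftrightarrow> (\<forall>x\<in>\<Omega>. ((\<lambda>t. f (x + t *\<^sub>R v i)) has_vector_derivative f' x) (at 0))"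

lemma partial_eq: "has_partial i f f' \<Longrightarrow> x \<in> \<Omega> \<Longrightarrow> partial v i f x = f' x"
  by (auto simp: has_partial_def partial_def intro: vector_derivative_at)

text \<open>Derivatives at a point of \<open>\<Omega>\<close> are determined on a short segment
  inside \<open>\<Omega>\<close>. Thus formulas that hold on \<open>\<Omega>\<close> only may be
  substituted into iterated derivatives of total functions.\<close>

lemma partial_cong:
  assumes eq: "\<And>x. x \<in> \<Omega> \<Longrightarrow> f x = g x" and i: "i \<le> m" and x: "x \<in> \<Omega>"
  shows "partial v i f x = partial v i g x"
    and "(\<lambda>t. f (x + t *\<^sub>R v i)) differentiable (at (0::real)) \<longleftrightarrow> (\<lambda>t. g (x + t *\<^sub>R v i)) differentiable (at (0::real))"
proof -
  obtain S where S: "open S" "(0::real) \<in> S" "\<And>t. t \<in> S \<Longrightarrow> x + t *\<^sub>R v i \<in> \<Omega>"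
    using line_in_Omega [OF x i] by blast
  have *: "((\<lambda>t. f (x + t *\<^sub>R v i)) has_vector_derivative d) (at 0) \<longleftrightarrow>
     ((\<lambda>t. g (x + t *\<^sub>R v i)) has_vector_derivative d) (at 0)" for d
  proof
    assume "((\<lambda>t. f (x + t *\<^sub>R v i)) has_vector_derivative d) (at 0)"
    then show "((\<lambda>t. g (x + t *\<^sub>R v i)) has_vector_derivative d) (at 0)"
      by (rule has_vector_derivative_transform_within_open [OF _ S(1,2)]) (simp add: S(3) eq)
  next
    assume "((\<lambda>t. g (x + t *\<^sub>R v i)) has_vector_derivative d) (at 0)"
    then show "((\<lambda>t. f (x + t *\<^sub>R v i)) has_vector_derivative d) (at 0)"
      by (rule has_vector_derivative_transform_within_open [OF _ S(1,2)]) (simp add: S(3) eq)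
  qed
  show "partial v i f x = partial v i g x"
    by (simp add: partial_def vector_derivative_def *)
  show "(\<lambda>t. f (x + t *\<^sub>R v i)) differentiable (at (0::real)) \<longleftrightarrow> (\<lambda>t. g (x + t *\<^sub>R v i)) differentiable (at (0::real))"
  proof -
    have "h differentiable (at 0) \<longleftrightarrow> (\<exists>d. (h has_vector_derivative d) (at 0))" for h :: "real \<Rightarrow> 'a"
      using differentiableI_vector vector_derivative_works by blast
    then show ?thesis by (simp only: *)
  qed
qed

lemma Ck_on_cong:
  assumes "\<And>x. x \<in> \<Omega> \<Longrightarrow> f x = g x"
  shows "Ck_on k m v \<Omega> f \<longleftrightarrow> Ck_on k m v \<Omega> g"
  using assms
proof (induction k arbitrary: f g)
  case 0
  show ?case unfolding Ck_on.simps by (rule continuous_on_cong [OF refl 0])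
next
  case (Suc k)
  have "Ck_on k m v \<Omega> (partial v i f) \<longleftrightarrow> Ck_on k m v \<Omega> (partial v i g)" if "i \<le> m" for i
    by (rule Suc.IH) (rule partial_cong(1) [OF Suc.prems that])
  moreover have "(\<lambda>t. f (x + t *\<^sub>R v i)) differentiable (at (0::real)) \<longleftrightarrow>
      (\<lambda>t. g (x + t *\<^sub>R v i)) differentiable (at (0::real))" if "i \<le> m" "x \<in> \<Omega>" for i x
    by (rule partial_cong(2) [OF Suc.prems that])
  ultimately show ?case unfolding Ck_on.simps by blast
qed

lemma dbar_cong:
  assumes "\<And>x. x \<in> \<Omega> \<Longrightarrow> f x = g x" "x \<in> \<Omega>"
  shows "dbar m v f x = dbar m v g x"
  unfolding dbar_def using partial_cong(1) [OF assms(1) _ assms(2)] by simp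

lemma laplace_cong:
  assumes "\<And>x. x \<in> \<Omega> \<Longrightarrow> f x = g x" "x \<in> \<Omega>"
  shows "laplace m v f x = laplace m v g x"
proof -
  have "partial v i (partial v i f) x = partial v i (partial v i g) x" if "i \<le> m" for i
    by (rule partial_cong(1) [OF _ that assms(2)]) (rule partial_cong(1) [OF assms(1) that])
  then show ?thesis by (simp add: laplace_def)
qed

lemma has_partial_add:
  "has_partial i f f' \<Longrightarrow> has_partial i g g' \<Longrightarrow> has_partial i (\<lambda>x. f x + g x) (\<lambda>x. f' x + g' x)"
  by (simp add: has_partial_def has_vector_derivative_add)

lemma has_partial_diff:
  "has_partial i f f' \<Longrightarrow> has_partial i g g' \<Longrightarrow> has_partial i (\<lambda>x. f x - g x) (\<lambda>x. f' x - g' x)"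
  by (simp add: has_partial_def has_vector_derivative_diff)

lemma has_partial_scaleR:
  "has_partial i f f' \<Longrightarrow> has_partial i (\<lambda>x. r *\<^sub>R f x) (\<lambda>x. r *\<^sub>R f' x)"
  unfolding has_partial_def
  by (auto intro: bounded_linear.has_vector_derivative [OF bounded_linear_scaleR_right])

lemma has_partial_form_scaleR:
  assumes "has_partial i f f'"
  shows "has_partial i (\<lambda>x. form x w *\<^sub>R f x) (\<lambda>x. form (v i) w *\<^sub>R f x + form x w *\<^sub>R f' x)"
  unfolding has_partial_def
proof
  fix x assume x: "x \<in> \<Omega>"
  have "((\<lambda>t. form (x + t *\<^sub>R v i) w) has_vector_derivative form (v i) w) (at 0)"
    by (auto simp: form_bl.add_left form_bl.scaleR_left intro!: derivative_eq_intros)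
  moreover have "((\<lambda>t. f (x + t *\<^sub>R v i)) has_vector_derivative f' x) (at 0)"
    using assms x by (simp add: has_partial_def)
  ultimately show "((\<lambda>t. form (x + t *\<^sub>R v i) w *\<^sub>R f (x + t *\<^sub>R v i)) has_vector_derivative
      form (v i) w *\<^sub>R f x + form x w *\<^sub>R f' x) (at 0)"
    using bounded_bilinear.has_vector_derivative [OF bounded_bilinear_scaleR] by (fastforce simp: add.commute)
qed

lemma has_partial_star_mult:
  assumes "has_partial i f f'"
  shows "has_partial i (\<lambda>x. star x * f x) (\<lambda>x. star (v i) * f x + star x * f' x)"
  unfolding has_partial_def
proof
  fix x assume x: "x \<in> \<Omega>"
  have "((\<lambda>t. star (x + t *\<^sub>R v i)) has_vector_derivative star (v i)) (at 0)"
    by (auto simp: star_add star_scaleR intro!: derivative_eq_intros)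
  moreover have "((\<lambda>t. f (x + t *\<^sub>R v i)) has_vector_derivative f' x) (at 0)"
    using assms x by (simp add: has_partial_def)
  ultimately show "((\<lambda>t. star (x + t *\<^sub>R v i) * f (x + t *\<^sub>R v i)) has_vector_derivative
      star (v i) * f x + star x * f' x) (at 0)"
    using bounded_bilinear.has_vector_derivative [OF bounded_bilinear_alg_mult] by (fastforce simp: add.commute)
qed

lemma has_partial_const_mult:
  "has_partial i f f' \<Longrightarrow> has_partial i (\<lambda>x. a * f x) (\<lambda>x. a * f' x)"
  unfolding has_partial_def
  by (auto intro: bounded_linear.has_vector_derivative [OF bounded_bilinear.bounded_linear_right [OF bounded_bilinear_alg_mult]])

text \<open>
  \<open>E\<close> is a basis of the algebra, or just \<open>{1}\<close> when the data are real-valued, and \<open>\<psi> e\<close> is the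
  coefficient of \<open>e\<close> in an algebra-valued holomorphic function.
\<close>

definition slice_dd :: "nat \<Rightarrow> ('a \<Rightarrow> complex \<Rightarrow> complex) \<Rightarrow> complex \<Rightarrow> 'a" where
  "slice_dd q \<psi> z = (\<Sum>e\<in>E. Re (dd q (\<psi> e) z) *\<^sub>R e)"

definition axial_dd :: "nat \<Rightarrow> ('a \<Rightarrow> complex \<Rightarrow> complex) \<Rightarrow> 'a \<Rightarrow> 'a" where
  "axial_dd q \<psi> x = slice_dd q \<psi> (slice_coord x)"

definition times_id :: "('a \<Rightarrow> complex \<Rightarrow> complex) \<Rightarrow> 'a \<Rightarrow> complex \<Rightarrow> complex" where
  "times_id \<psi> e w = w * \<psi> e w"

definition hol :: "('a \<Rightarrow> complex \<Rightarrow> complex) \<Rightarrow> bool" where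
  "hol \<psi> \<longleftrightarrow> (\<forall>e\<in>E. \<psi> e holomorphic_on D)"

lemma hol_times_id: "hol \<psi> \<Longrightarrow> hol (times_id \<psi>)"
  unfolding hol_def times_id_def by (auto intro: holomorphic_on_mult)

lemma slice_dd_cnj: "slice_dd q \<psi> (cnj z) = slice_dd q \<psi> z"
  by (simp add: slice_dd_def dd_cnj)

lemma continuous_on_axial_dd:
  assumes "hol \<psi>"
  shows "continuous_on \<Omega> (axial_dd q \<psi>)"
proof -
  have "continuous_on D (slice_dd q \<psi>)"
    unfolding slice_dd_def using assms by (intro continuous_intros continuous_on_dd) (simp add: hol_def)
  moreover have "continuous_on \<Omega> slice_coord"
    using continuous_on_slice_coord continuous_on_subset by blast
  ultimately show ?thesis
    unfolding axial_dd_def [abs_def] by (rule continuous_on_compose2) (auto simp: Omega_iff)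
qed

lemma axial_dd_expand:
  assumes "hol \<psi>" "x \<in> \<Omega>"
  shows "axial_dd q \<psi> x = axial_dd (Suc q) (times_id (times_id \<psi>)) x - (2 * form x 1) *\<^sub>R axial_dd (Suc q) (times_id \<psi>) x
    + form x x *\<^sub>R axial_dd (Suc q) \<psi> x"
proof -
  have x: "x \<in> M" "slice_coord x \<in> D" using assms by (auto simp: Omega_iff)
  have "Re (dd q (\<psi> e) (slice_coord x)) *\<^sub>R e
     = Re (dd (Suc q) (times_id (times_id \<psi>) e) (slice_coord x)) *\<^sub>R e
       - (2 * form x 1) *\<^sub>R (Re (dd (Suc q) (times_id \<psi> e) (slice_coord x)) *\<^sub>R e)
       + form x x *\<^sub>R (Re (dd (Suc q) (\<psi> e) (slice_coord x)) *\<^sub>R e)" if "e \<in> E" for e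
    using assms(1) that x
    by (subst dd_Suc_expand [of "\<psi> e"])
      (simp_all add: hol_def times_id_def [abs_def] cmod_slice_coord Re_slice_coord algebra_simps)
  then show ?thesis
    unfolding axial_dd_def slice_dd_def scaleR_sum_right sum.distrib [symmetric] sum_subtractf [symmetric]
    by (rule sum.cong [OF refl])
qed

text \<open>Along the line in direction \<open>v i\<close> the real part and the squared modulus of
  \<open>slice_coord\<close> are polynomials in \<open>t\<close> with linear coefficients
  \<open>form (v i) 1\<close> and \<open>2 * form x (v i)\<close>. Hence
  \<open>has_vector_derivative_dd\<close> applies also at real \<open>x\<close>.\<close>

lemma has_partial_axial_dd:
  assumes \<psi>: "hol \<psi>" and i: "i \<le> m"
  shows "has_partial i (axial_dd q \<psi>)
    (\<lambda>x. (-2 * real (Suc q)) *\<^sub>R (form x (v i) *\<^sub>R axial_dd (Suc q) \<psi> x - form (v i) 1 *\<^sub>R axial_dd (Suc q) (times_id \<psi>) x))"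
  unfolding has_partial_def
proof
  fix x assume "x \<in> \<Omega>"
  then have x: "x \<in> M" "slice_coord x \<in> D" by (auto simp: Omega_iff)
  let ?z = "\<lambda>t. slice_coord (x + t *\<^sub>R v i)"
  have xt: "x + t *\<^sub>R v i \<in> M" for t by (rule line_in_M [OF x(1) i])
  have re: "Re (?z t) = form x 1 + form (v i) 1 * t" for t
    by (simp add: Re_slice_coord [OF xt] form_bl.add_left form_bl.scaleR_left)
  have nm: "(cmod (?z t))\<^sup>2 = form x x + 2 * form x (v i) * t + 1 * t\<^sup>2" for t
    unfolding cmod_slice_coord [OF xt] using i by (simp add: form_bl.add_left form_bl.add_right form_bl.scaleR_left
        form_bl.scaleR_right form_v form_commute [of "v i" x] power2_eq_square algebra_simps)
  have "((\<lambda>t. \<Sum>e\<in>E. Re (dd q (\<psi> e) (?z t)) *\<^sub>R e) has_vector_derivative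
      (\<Sum>e\<in>E. (real (Suc q) * (2 * form (v i) 1 * Re (dd (Suc q) (times_id \<psi> e) (slice_coord x))
          - 2 * form x (v i) * Re (dd (Suc q) (\<psi> e) (slice_coord x)))) *\<^sub>R e)) (at 0)"
  proof (rule has_vector_derivative_sum)
    fix e assume "e \<in> E"
    then have "\<psi> e holomorphic_on D" using \<psi> by (simp add: hol_def)
    from has_vector_derivative_dd [OF this _ continuous_on_line_slice_coord re nm, of q] x
    have "((\<lambda>t. dd q (\<psi> e) (?z t)) has_vector_derivative
        of_nat (Suc q) * (of_real (2 * form (v i) 1) * dd (Suc q) (\<lambda>w. w * \<psi> e w) (slice_coord x)
          - of_real (2 * form x (v i)) * dd (Suc q) (\<psi> e) (slice_coord x))) (at 0)"
      by (simp del: of_nat_Suc)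
    from bounded_linear.has_vector_derivative [OF bounded_linear_scaleR_left
        bounded_linear.has_vector_derivative [OF bounded_linear_Re this], of e]
    show "((\<lambda>t. Re (dd q (\<psi> e) (?z t)) *\<^sub>R e) has_vector_derivative
      (real (Suc q) * (2 * form (v i) 1 * Re (dd (Suc q) (times_id \<psi> e) (slice_coord x))
          - 2 * form x (v i) * Re (dd (Suc q) (\<psi> e) (slice_coord x)))) *\<^sub>R e) (at 0)"
      by (simp add: times_id_def [abs_def] del: of_nat_Suc)
  qed
  also have "(\<Sum>e\<in>E. (real (Suc q) * (2 * form (v i) 1 * Re (dd (Suc q) (times_id \<psi> e) (slice_coord x))
          - 2 * form x (v i) * Re (dd (Suc q) (\<psi> e) (slice_coord x)))) *\<^sub>R e)
     = (-2 * real (Suc q)) *\<^sub>R (form x (v i) *\<^sub>R axial_dd (Suc q) \<psi> x - form (v i) 1 *\<^sub>R axial_dd (Suc q) (times_id \<psi>) x)"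
    unfolding axial_dd_def slice_dd_def scaleR_sum_right sum_subtractf [symmetric]
    by (intro sum.cong refl) (simp add: algebra_simps)
  finally show "((\<lambda>t. axial_dd q \<psi> (x + t *\<^sub>R v i)) has_vector_derivative
     (-2 * real (Suc q)) *\<^sub>R (form x (v i) *\<^sub>R axial_dd (Suc q) \<psi> x - form (v i) 1 *\<^sub>R axial_dd (Suc q) (times_id \<psi>) x)) (at 0)"
    by (simp only: axial_dd_def slice_dd_def)
qed

text \<open>A class closed under partial differentiation: the constructors include all operations
  that occur in derivatives of its members. One first-order computation thus yields every order of
  differentiability.\<close>

inductive smooth :: "('a \<Rightarrow> 'a) \<Rightarrow> bool" where
  axial_dd: "hol \<psi> \<Longrightarrow> smooth (axial_dd q \<psi>)"
| add: "smooth f \<Longrightarrow> smooth g \<Longrightarrow> smooth (\<lambda>x. f x + g x)"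
| scaleR: "smooth f \<Longrightarrow> smooth (\<lambda>x. r *\<^sub>R f x)"
| form: "smooth f \<Longrightarrow> smooth (\<lambda>x. form x w *\<^sub>R f x)"
| const_mult: "smooth f \<Longrightarrow> smooth (\<lambda>x. a * f x)"
| star_mult: "smooth f \<Longrightarrow> smooth (\<lambda>x. star x * f x)"

lemma smooth_diff: "smooth f \<Longrightarrow> smooth g \<Longrightarrow> smooth (\<lambda>x. f x - g x)"
  using smooth.add [OF _ smooth.scaleR [of g "-1"], of f] by simp

lemma smooth_continuous_on: "smooth f \<Longrightarrow> continuous_on \<Omega> f"
proof (induction rule: smooth.induct)
  case (star_mult f)
  have "continuous_on \<Omega> (star :: 'a \<Rightarrow> 'a)"
    using bounded_linear_star by (rule linear_continuous_on)
  with star_mult show ?case by (intro alg.continuous_on)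
next
  case (form f w)
  then show ?case by (intro continuous_intros form_bl.continuous_on)
qed (auto intro!: continuous_intros continuous_on_axial_dd alg.continuous_on)

lemma smooth_has_partial: "smooth f \<Longrightarrow> i \<le> m \<Longrightarrow> \<exists>f'. smooth f' \<and> has_partial i f f'"
proof (induction rule: smooth.induct)
  case (axial_dd \<psi> q)
  show ?case
    by (rule exI, rule conjI [rotated], rule has_partial_axial_dd [OF axial_dd])
      (intro smooth.scaleR smooth_diff smooth.axial_dd smooth.form axial_dd(1) hol_times_id)
next
  case (add f g)
  then obtain f' g' where d: "smooth f'" "has_partial i f f'" "smooth g'" "has_partial i g g'" by blast
  show ?case
    by (rule exI, rule conjI [OF _ has_partial_add [OF d(2,4)]], rule smooth.add [OF d(1,3)])
next
  case (scaleR f r)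
  then obtain f' where f': "smooth f'" "has_partial i f f'" by blast
  show ?case
    by (rule exI, rule conjI [OF _ has_partial_scaleR [OF f'(2)]], rule smooth.scaleR [OF f'(1)])
next
  case (form f w)
  then obtain f' where f': "smooth f'" "has_partial i f f'" by blast
  show ?case
    by (rule exI, rule conjI [OF _ has_partial_form_scaleR [OF f'(2)]],
      rule smooth.add [OF smooth.scaleR [OF form.hyps] smooth.form [OF f'(1)]])
next
  case (const_mult f a)
  then obtain f' where f': "smooth f'" "has_partial i f f'" by blast
  show ?case
    by (rule exI, rule conjI [OF _ has_partial_const_mult [OF f'(2)]], rule smooth.const_mult [OF f'(1)])
next
  case (star_mult f)
  then obtain f' where f': "smooth f'" "has_partial i f f'" by blast
  show ?case
    by (rule exI, rule conjI [OF _ has_partial_star_mult [OF f'(2)]],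
      rule smooth.add [OF smooth.const_mult [OF star_mult.hyps] smooth.star_mult [OF f'(1)]])
qed

lemma smooth_Ck_on: "smooth f \<Longrightarrow> Ck_on k m v \<Omega> f"
proof (induction k arbitrary: f)
  case 0
  then show ?case by (simp add: smooth_continuous_on)
next
  case (Suc k)
  have "(\<forall>x\<in>\<Omega>. (\<lambda>t. f (x + t *\<^sub>R v i)) differentiable (at (0::real))) \<and> Ck_on k m v \<Omega> (partial v i f)" if i: "i \<le> m" for i
  proof -
    obtain f' where f': "smooth f'" "has_partial i f f'"
      using smooth_has_partial [OF Suc.prems i] by blast
    have "Ck_on k m v \<Omega> (partial v i f) \<longleftrightarrow> Ck_on k m v \<Omega> f'"
      by (rule Ck_on_cong) (rule partial_eq [OF f'(2)])
    with Suc.IH f' show ?thesis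
      by (auto simp: has_partial_def intro: differentiableI_vector)
  qed
  then show ?case by simp
qed

subsection \<open>The Laplacian and the conjugate derivative\<close>

lemma sum_form_v_one: "(\<Sum>i\<le>m. form (v i) 1 *\<^sub>R g i) = (g 0 :: 'a)"
proof -
  have "(\<Sum>i\<le>m. form (v i) 1 *\<^sub>R g i) = (\<Sum>i\<le>m. if i = 0 then g 0 else 0)"
    by (intro sum.cong) (auto simp: form_v_one)
  then show ?thesis by simp
qed

text \<open>
  Besides the Laplacian, the conjugate derivative \<open>S\<close> is recorded, as it enters the Laplacian of
  \<open>x \<mapsto> star x * f x\<close>.
\<close>

definition laplace_data :: "('a \<Rightarrow> 'a) \<Rightarrow> ('a \<Rightarrow> 'a) \<Rightarrow> ('a \<Rightarrow> 'a) \<Rightarrow> bool" where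
  "laplace_data f S L \<longleftrightarrow> (\<exists>f' f''. (\<forall>i\<le>m. has_partial i f (f' i) \<and> has_partial i (f' i) (f'' i)) \<and>
     (\<forall>x\<in>\<Omega>. (\<Sum>i\<le>m. star (v i) * f' i x) = S x \<and> (\<Sum>i\<le>m. f'' i x) = L x))"

lemma laplace_dataI:
  assumes "\<And>i. i \<le> m \<Longrightarrow> has_partial i f (f' i)" "\<And>i. i \<le> m \<Longrightarrow> has_partial i (f' i) (f'' i)"
    and "\<And>x. x \<in> \<Omega> \<Longrightarrow> (\<Sum>i\<le>m. star (v i) * f' i x) = S x"
    and "\<And>x. x \<in> \<Omega> \<Longrightarrow> (\<Sum>i\<le>m. f'' i x) = L x"
  shows "laplace_data f S L"
  unfolding laplace_data_def
  by (rule exI [of _ f'], rule exI [of _ f'']) (simp add: assms)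

lemma laplace_eq:
  assumes "laplace_data f S L" and x: "x \<in> \<Omega>"
  shows "laplace m v f x = L x"
proof -
  from assms(1) obtain f' f'' where *: "\<forall>i\<le>m. has_partial i f (f' i) \<and> has_partial i (f' i) (f'' i)"
    "\<forall>x\<in>\<Omega>. (\<Sum>i\<le>m. star (v i) * f' i x) = S x \<and> (\<Sum>i\<le>m. f'' i x) = L x"
    unfolding laplace_data_def by (elim exE conjE)
  note f = *(1) [rule_format, THEN conjunct1] *(1) [rule_format, THEN conjunct2]
    *(2) [rule_format, THEN conjunct1] *(2) [rule_format, THEN conjunct2]
  have "partial v i (partial v i f) x = f'' i x" if i: "i \<le> m" for i
  proof -
    have "partial v i (partial v i f) x = partial v i (f' i) x"
      by (rule partial_cong(1) [OF _ i x]) (rule partial_eq [OF f(1) [OF i]])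
    also have "\<dots> = f'' i x" by (rule partial_eq [OF f(2) [OF i] x])
    finally show ?thesis .
  qed
  then have "laplace m v f x = (\<Sum>i\<le>m. f'' i x)"
    unfolding laplace_def atMost_atLeast0 by (intro sum.cong refl) simp
  then show ?thesis by (simp only: f(4) [OF x])
qed

lemma laplace_data_scaleR:
  assumes "laplace_data f S L"
  shows "laplace_data (\<lambda>x. r *\<^sub>R f x) (\<lambda>x. r *\<^sub>R S x) (\<lambda>x. r *\<^sub>R L x)"
proof -
  from assms obtain f' f'' where *: "\<forall>i\<le>m. has_partial i f (f' i) \<and> has_partial i (f' i) (f'' i)"
    "\<forall>x\<in>\<Omega>. (\<Sum>i\<le>m. star (v i) * f' i x) = S x \<and> (\<Sum>i\<le>m. f'' i x) = L x"
    unfolding laplace_data_def by (elim exE conjE)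
  note f = *(1) [rule_format, THEN conjunct1] *(1) [rule_format, THEN conjunct2]
    *(2) [rule_format, THEN conjunct1] *(2) [rule_format, THEN conjunct2]
  show ?thesis
    by (rule laplace_dataI [where f' = "\<lambda>i x. r *\<^sub>R f' i x" and f'' = "\<lambda>i x. r *\<^sub>R f'' i x"])
      (simp_all add: has_partial_scaleR f alg.scaleR_right scaleR_sum_right [symmetric])
qed

lemma laplace_data_diff:
  assumes "laplace_data f S L" "laplace_data g T K"
  shows "laplace_data (\<lambda>x. f x - g x) (\<lambda>x. S x - T x) (\<lambda>x. L x - K x)"
proof -
  from assms(1) obtain f' f'' where *: "\<forall>i\<le>m. has_partial i f (f' i) \<and> has_partial i (f' i) (f'' i)"
    "\<forall>x\<in>\<Omega>. (\<Sum>i\<le>m. star (v i) * f' i x) = S x \<and> (\<Sum>i\<le>m. f'' i x) = L x"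
    unfolding laplace_data_def by (elim exE conjE)
  note f = *(1) [rule_format, THEN conjunct1] *(1) [rule_format, THEN conjunct2]
    *(2) [rule_format, THEN conjunct1] *(2) [rule_format, THEN conjunct2]
  from assms(2) obtain g' g'' where *: "\<forall>i\<le>m. has_partial i g (g' i) \<and> has_partial i (g' i) (g'' i)"
    "\<forall>x\<in>\<Omega>. (\<Sum>i\<le>m. star (v i) * g' i x) = T x \<and> (\<Sum>i\<le>m. g'' i x) = K x"
    unfolding laplace_data_def by (elim exE conjE)
  note g = *(1) [rule_format, THEN conjunct1] *(1) [rule_format, THEN conjunct2]
    *(2) [rule_format, THEN conjunct1] *(2) [rule_format, THEN conjunct2]
  show ?thesis
    by (rule laplace_dataI [where f' = "\<lambda>i x. f' i x - g' i x" and f'' = "\<lambda>i x. f'' i x - g'' i x"])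
      (simp_all add: has_partial_diff f g alg.diff_right sum_subtractf)
qed

text \<open>Since \<open>star\<close> is linear, its second derivatives vanish, and the two equal
  cross terms give twice the conjugate derivative.\<close>

lemma laplace_data_star_mult:
  assumes "laplace_data f S L"
  shows "\<exists>S'. laplace_data (\<lambda>x. star x * f x) S' (\<lambda>x. 2 *\<^sub>R S x + star x * L x)"
proof -
  from assms obtain f' f'' where *: "\<forall>i\<le>m. has_partial i f (f' i) \<and> has_partial i (f' i) (f'' i)"
    "\<forall>x\<in>\<Omega>. (\<Sum>i\<le>m. star (v i) * f' i x) = S x \<and> (\<Sum>i\<le>m. f'' i x) = L x"
    unfolding laplace_data_def by (elim exE conjE)
  note f = *(1) [rule_format, THEN conjunct1] *(1) [rule_format, THEN conjunct2]
    *(2) [rule_format, THEN conjunct1] *(2) [rule_format, THEN conjunct2]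
  let ?F' = "\<lambda>i x. star (v i) * f x + star x * f' i x"
  let ?F'' = "\<lambda>i x. star (v i) * f' i x + (star (v i) * f' i x + star x * f'' i x)"
  have "laplace_data (\<lambda>x. star x * f x) (\<lambda>x. \<Sum>i\<le>m. star (v i) * ?F' i x) (\<lambda>x. 2 *\<^sub>R S x + star x * L x)"
  proof (rule laplace_dataI [where f' = ?F' and f'' = ?F''])
    fix i assume i: "i \<le> m"
    show "has_partial i (\<lambda>x. star x * f x) (?F' i)"
      by (rule has_partial_star_mult [OF f(1) [OF i]])
    show "has_partial i (?F' i) (?F'' i)"
      by (rule has_partial_add [OF has_partial_const_mult [OF f(1) [OF i]] has_partial_star_mult [OF f(2) [OF i]]])
  next
    fix x assume "x \<in> \<Omega>"
    then show "(\<Sum>i\<le>m. ?F'' i x) = 2 *\<^sub>R S x + star x * L x"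
      by (simp add: f(3,4) sum.distrib alg.sum_right [symmetric] scaleR_2 add.assoc)
  qed (rule refl)
  then show ?thesis by blast
qed

lemma sum_star_partials:
  assumes "x \<in> M"
  shows "(\<Sum>i\<le>m. star (v i) * (k *\<^sub>R (form x (v i) *\<^sub>R P - form (v i) 1 *\<^sub>R Q))) = k *\<^sub>R (star x * P - Q)"
  using sum_form_v_one [of "\<lambda>i. star (v i) * Q"] sum_left_mult_coordinates(2) [OF assms]
  by (simp add: alg.diff_right alg.scaleR_right sum_subtractf scaleR_sum_right [symmetric] v_0 star_one mult_one_left)

text \<open>Differentiating the coordinate factors contributes \<open>m + 1\<close> copies of
  \<open>?P\<close>. The terms of exponent \<open>Suc (Suc q)\<close> recombine into another
  multiple of \<open>?P\<close> by \<open>axial_dd_expand\<close>.\<close>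

lemma laplace_data_axial_dd:
  assumes \<psi>: "hol \<psi>"
  shows "laplace_data (axial_dd q \<psi>)
    (\<lambda>x. (-2 * real (Suc q)) *\<^sub>R (star x * axial_dd (Suc q) \<psi> x - axial_dd (Suc q) (times_id \<psi>) x))
    (\<lambda>x. (-2 * real (Suc q) * (real m + 1 - 2 * real (Suc (Suc q)))) *\<^sub>R axial_dd (Suc q) \<psi> x)"
proof -
  define k where "k = - 2 * real (Suc q)"
  define l where "l = - 2 * real (Suc (Suc q))"
  let ?P = "axial_dd (Suc q) \<psi>" and ?Q = "axial_dd (Suc q) (times_id \<psi>)"
    and ?R0 = "axial_dd (Suc (Suc q)) \<psi>" and ?R1 = "axial_dd (Suc (Suc q)) (times_id \<psi>)"
    and ?R2 = "axial_dd (Suc (Suc q)) (times_id (times_id \<psi>))"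
  let ?P' = "\<lambda>i x. l *\<^sub>R (form x (v i) *\<^sub>R ?R0 x - form (v i) 1 *\<^sub>R ?R1 x)"
  let ?Q' = "\<lambda>i x. l *\<^sub>R (form x (v i) *\<^sub>R ?R1 x - form (v i) 1 *\<^sub>R ?R2 x)"
  let ?f' = "\<lambda>i x. k *\<^sub>R (form x (v i) *\<^sub>R ?P x - form (v i) 1 *\<^sub>R ?Q x)"
  let ?f'' = "\<lambda>i x. k *\<^sub>R ((form (v i) (v i) *\<^sub>R ?P x + form x (v i) *\<^sub>R ?P' i x) - form (v i) 1 *\<^sub>R ?Q' i x)"
  have P: "has_partial i ?P (?P' i)" and Q: "has_partial i ?Q (?Q' i)" if "i \<le> m" for i
    using has_partial_axial_dd [OF \<psi> that, of "Suc q"] has_partial_axial_dd [OF hol_times_id [OF \<psi>] that, of "Suc q"]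
    by (simp_all only: l_def)
  have d1: "has_partial i (axial_dd q \<psi>) (?f' i)" if i: "i \<le> m" for i
    using has_partial_axial_dd [OF \<psi> i, of q] unfolding k_def .
  have d2: "has_partial i (?f' i) (?f'' i)" if i: "i \<le> m" for i
    by (rule has_partial_scaleR [OF has_partial_diff [OF has_partial_form_scaleR [OF P [OF i]] has_partial_scaleR [OF Q [OF i]]]])
  have s1: "(\<Sum>i\<le>m. star (v i) * ?f' i x) = k *\<^sub>R (star x * ?P x - ?Q x)" if "x \<in> \<Omega>" for x
    using that by (intro sum_star_partials) (simp add: Omega_iff)
  have s2: "(\<Sum>i\<le>m. ?f'' i x) = (k * (real m + 1 + l)) *\<^sub>R ?P x" if x: "x \<in> \<Omega>" for x
  proof -
    have xM: "x \<in> M" using x by (simp add: Omega_iff)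
    have ex: "?P x = ?R2 x - (2 * form x 1) *\<^sub>R ?R1 x + form x x *\<^sub>R ?R0 x"
      by (rule axial_dd_expand [OF \<psi> x])
    let ?Z = "?R2 x - (2 * form x 1) *\<^sub>R ?R1 x"
    \<comment> \<open>In direction \<open>v 0\<close> the two terms with \<open>?R1\<close> add up
      to the coefficient \<open>2 * form x 1\<close>; in the other directions
      \<open>form (v i) 1 = 0\<close>.\<close>
    have summand: "?f'' i x = k *\<^sub>R (?P x + l *\<^sub>R ((form x (v i))\<^sup>2 *\<^sub>R ?R0 x + form (v i) 1 *\<^sub>R ?Z))" if i: "i \<le> m" for i
      using i by (cases "i = 0")
        (simp_all add: form_v form_v_one v_0 [symmetric] algebra_simps power2_eq_square,
         simp_all add: scaleR_add_left [symmetric])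
    have "(\<Sum>i\<le>m. (form x (v i))\<^sup>2 *\<^sub>R ?R0 x + form (v i) 1 *\<^sub>R ?Z)
        = (\<Sum>i\<le>m. (form x (v i))\<^sup>2) *\<^sub>R ?R0 x + ?Z"
      by (simp only: sum.distrib scaleR_sum_left sum_form_v_one)
    then have quad: "(\<Sum>i\<le>m. (form x (v i))\<^sup>2 *\<^sub>R ?R0 x + form (v i) 1 *\<^sub>R ?Z) = ?P x"
      by (simp only: sum_coordinates_squared [OF xM] ex add.commute)
    have const: "(\<Sum>i\<le>m. ?P x) = (real m + 1) *\<^sub>R ?P x"
      by (simp add: sum_constant_scaleR add.commute)
    have "(\<Sum>i\<le>m. ?f'' i x) = (\<Sum>i\<le>m. k *\<^sub>R (?P x + l *\<^sub>R ((form x (v i))\<^sup>2 *\<^sub>R ?R0 x + form (v i) 1 *\<^sub>R ?Z)))"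
      by (intro sum.cong refl summand) simp
    also have "\<dots> = k *\<^sub>R ((\<Sum>i\<le>m. ?P x) + l *\<^sub>R (\<Sum>i\<le>m. (form x (v i))\<^sup>2 *\<^sub>R ?R0 x + form (v i) 1 *\<^sub>R ?Z))"
      unfolding scaleR_sum_right sum.distrib [symmetric] ..
    also have "\<dots> = (k * (real m + 1 + l)) *\<^sub>R ?P x"
      unfolding quad const by (simp only: scaleR_add_left [symmetric] scaleR_scaleR)
    finally show "(\<Sum>i\<le>m. ?f'' i x) = (k * (real m + 1 + l)) *\<^sub>R ?P x" .
  qed
  have "laplace_data (axial_dd q \<psi>) (\<lambda>x. k *\<^sub>R (star x * ?P x - ?Q x)) (\<lambda>x. (k * (real m + 1 + l)) *\<^sub>R ?P x)"
    by (rule laplace_dataI [OF d1 d2 s1 s2])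
  then show ?thesis by (simp add: k_def l_def)
qed

section \<open>The components and their Laplacians\<close>

definition slice_comp :: "nat \<Rightarrow> ('a \<Rightarrow> complex \<Rightarrow> complex) \<Rightarrow> ('a \<Rightarrow> complex \<Rightarrow> complex) \<Rightarrow> 'a \<Rightarrow> 'a" where
  "slice_comp q \<alpha> \<beta> x = axial_dd q \<alpha> x - star x * axial_dd q \<beta> x"

lemma smooth_slice_comp: "hol \<alpha> \<Longrightarrow> hol \<beta> \<Longrightarrow> smooth (slice_comp q \<alpha> \<beta>)"
  unfolding slice_comp_def [abs_def] by (intro smooth_diff smooth.axial_dd smooth.star_mult)

text \<open>For \<open>q > 0\<close> the conjugate derivative of
  \<open>axial_dd (q - 1) \<beta>\<close> is \<open>- 2 * q\<close> times this function.\<close>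

definition axial :: "nat \<Rightarrow> ('a \<Rightarrow> complex \<Rightarrow> complex) \<Rightarrow> 'a \<Rightarrow> 'a" where
  "axial q \<beta> x = star x * axial_dd q \<beta> x - axial_dd q (times_id \<beta>) x"

text \<open>The factor \<open>m + 1 - 2 * (n + 2)\<close> is zero, so both residue sums are
  harmonic. Only the cross term of the product with \<open>star x\<close> remains, and
  \<open>\<alpha>\<close> drops out.\<close>

lemma laplace_slice_comp:
  assumes m: "m = 2 * n + 3" and hol: "hol \<alpha>" "hol \<beta>" and x: "x \<in> \<Omega>"
  shows "laplace m v (slice_comp n \<alpha> \<beta>) x = (4 * real (Suc n)) *\<^sub>R axial (Suc n) \<beta> x"
proof -
  obtain S where "laplace_data (\<lambda>x. star x * axial_dd n \<beta> x) S (\<lambda>x. 2 *\<^sub>R ((-2 * real (Suc n)) *\<^sub>R (star x * axial_dd (Suc n) \<beta> x - axial_dd (Suc n) (times_id \<beta>) x))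
      + star x * ((-2 * real (Suc n) * (real m + 1 - 2 * real (Suc (Suc n)))) *\<^sub>R axial_dd (Suc n) \<beta> x))"
    using laplace_data_star_mult [OF laplace_data_axial_dd [OF hol(2)]] by blast
  from laplace_eq [OF laplace_data_diff [OF laplace_data_axial_dd [OF hol(1), of n] this] x]
  have "laplace m v (slice_comp n \<alpha> \<beta>) x =
      (-2 * real (Suc n) * (real m + 1 - 2 * real (Suc (Suc n)))) *\<^sub>R axial_dd (Suc n) \<alpha> x
      - (2 *\<^sub>R ((-2 * real (Suc n)) *\<^sub>R axial (Suc n) \<beta> x)
        + star x * ((-2 * real (Suc n) * (real m + 1 - 2 * real (Suc (Suc n)))) *\<^sub>R axial_dd (Suc n) \<beta> x))"
    unfolding slice_comp_def [abs_def] axial_def .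
  moreover have "real m + 1 - 2 * real (Suc (Suc n)) = 0"
    by (simp add: m)
  ultimately show ?thesis
    by (simp add: alg.zero_right del: of_nat_Suc)
qed

text \<open>At exponent \<open>Suc n\<close> the dimensional factor is \<open>- 2\<close> instead of
  0, and the Laplacians of the residue sums cancel the cross term exactly.\<close>

lemma laplace_axial:
  assumes m: "m = 2 * n + 3" and hol: "hol \<beta>" and x: "x \<in> \<Omega>"
  shows "laplace m v (\<lambda>x. c *\<^sub>R axial (Suc n) \<beta> x) x = 0"
proof -
  let ?q = "Suc n"
  obtain S where "laplace_data (\<lambda>x. star x * axial_dd ?q \<beta> x) S (\<lambda>x. 2 *\<^sub>R ((-2 * real (Suc ?q)) *\<^sub>R (star x * axial_dd (Suc ?q) \<beta> x - axial_dd (Suc ?q) (times_id \<beta>) x))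
      + star x * ((-2 * real (Suc ?q) * (real m + 1 - 2 * real (Suc (Suc ?q)))) *\<^sub>R axial_dd (Suc ?q) \<beta> x))"
    using laplace_data_star_mult [OF laplace_data_axial_dd [OF hol]] by blast
  from laplace_eq [OF laplace_data_scaleR [OF laplace_data_diff [OF this laplace_data_axial_dd [OF hol_times_id [OF hol], of ?q]]] x, of c]
  have "laplace m v (\<lambda>x. c *\<^sub>R axial (Suc n) \<beta> x) x = c *\<^sub>R
      (2 *\<^sub>R ((-2 * real (Suc ?q)) *\<^sub>R (star x * axial_dd (Suc ?q) \<beta> x - axial_dd (Suc ?q) (times_id \<beta>) x))
       + star x * ((-2 * real (Suc ?q) * (real m + 1 - 2 * real (Suc (Suc ?q)))) *\<^sub>R axial_dd (Suc ?q) \<beta> x)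
       - (-2 * real (Suc ?q) * (real m + 1 - 2 * real (Suc (Suc ?q)))) *\<^sub>R axial_dd (Suc ?q) (times_id \<beta>) x)"
    unfolding axial_def [abs_def] .
  moreover have "real m + 1 - 2 * real (Suc (Suc ?q)) = - 2"
    by (simp add: m)
  ultimately show ?thesis
    by (simp add: alg.scaleR_right scaleR_diff_right del: of_nat_Suc)
qed

lemma dbar_eq:
  assumes "\<And>i. i \<le> m \<Longrightarrow> has_partial i f (f' i)" "x \<in> \<Omega>"
  shows "dbar m v f x = (1/2) *\<^sub>R (\<Sum>i\<le>m. v i * f' i x)"
proof -
  have "(\<Sum>i\<le>m. v i * f' i x) = f' 0 x + (\<Sum>i=1..m. v i * f' i x)"
    by (simp add: atMost_atLeast0 sum.atLeast_Suc_atMost v_0 mult_one_left)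
  then show ?thesis
    unfolding dbar_def using partial_eq [OF assms(1) assms(2)] by simp
qed

text \<open>Alternativity reduces the double products \<open>v i * (star (v i) * y)\<close> and
  \<open>x * (star x * y)\<close> to real multiples of \<open>y\<close>. Then
  \<open>axial_dd_expand\<close> collapses everything to a multiple of \<open>?P\<close> with factor
  \<open>m + 1 - 2 * (n + 2) = 0\<close>.\<close>

lemma dbar_axial:
  assumes m: "m = 2 * n + 3" and hol: "hol \<beta>" and x: "x \<in> \<Omega>"
  shows "dbar m v (\<lambda>x. c *\<^sub>R axial (Suc n) \<beta> x) x = 0"
proof -
  define l where "l = - 2 * real (Suc (Suc n))"
  let ?P = "axial_dd (Suc n) \<beta>" and ?Q = "axial_dd (Suc n) (times_id \<beta>)"
    and ?R0 = "axial_dd (Suc (Suc n)) \<beta>" and ?R1 = "axial_dd (Suc (Suc n)) (times_id \<beta>)"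
    and ?R2 = "axial_dd (Suc (Suc n)) (times_id (times_id \<beta>))"
  let ?P' = "\<lambda>i x. l *\<^sub>R (form x (v i) *\<^sub>R ?R0 x - form (v i) 1 *\<^sub>R ?R1 x)"
  let ?Q' = "\<lambda>i x. l *\<^sub>R (form x (v i) *\<^sub>R ?R1 x - form (v i) 1 *\<^sub>R ?R2 x)"
  let ?f' = "\<lambda>i x. c *\<^sub>R ((star (v i) * ?P x + star x * ?P' i x) - ?Q' i x)"
  have xM: "x \<in> M" using x by (simp add: Omega_iff)
  have P: "has_partial i ?P (?P' i)" and Q: "has_partial i ?Q (?Q' i)" if "i \<le> m" for i
    using has_partial_axial_dd [OF hol that, of "Suc n"] has_partial_axial_dd [OF hol_times_id [OF hol] that, of "Suc n"]
    by (simp_all only: l_def)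
  have vs: "v i * (star (v i) * y) = y" if "i \<le> m" for i y
    using left_mult_star_M [OF v_M [OF that]] form_v [OF that that] by simp
  have mul: "(\<Sum>i\<le>m. v i * (form x (v i) *\<^sub>R A - form (v i) 1 *\<^sub>R B)) = x * A - B" for A B
    using sum_form_v_one [of "\<lambda>i. v i * B"] sum_left_mult_coordinates(1) [OF xM]
    by (simp add: alg.diff_right alg.scaleR_right sum_subtractf v_0 mult_one_left)
  have "dbar m v (\<lambda>x. c *\<^sub>R axial (Suc n) \<beta> x) x = (1/2) *\<^sub>R (\<Sum>i\<le>m. v i * ?f' i x)"
    unfolding axial_def [abs_def]
    by (rule dbar_eq [OF _ x]) (intro has_partial_scaleR has_partial_diff has_partial_star_mult P Q)
  also have "(\<Sum>i\<le>m. v i * ?f' i x) = (\<Sum>i\<le>m. c *\<^sub>R (?P x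
      + l *\<^sub>R (v i * (form x (v i) *\<^sub>R (star x * ?R0 x) - form (v i) 1 *\<^sub>R (star x * ?R1 x)))
      - l *\<^sub>R (v i * (form x (v i) *\<^sub>R ?R1 x - form (v i) 1 *\<^sub>R ?R2 x))))"
    by (intro sum.cong refl) (simp add: alg.add_right alg.diff_right alg.scaleR_right vs)
  also have "\<dots> = c *\<^sub>R ((real m + 1) *\<^sub>R ?P x + l *\<^sub>R (x * (star x * ?R0 x) - star x * ?R1 x) - l *\<^sub>R (x * ?R1 x - ?R2 x))"
    by (simp only: scaleR_sum_right [symmetric] sum.distrib sum_subtractf mul)
      (simp add: sum_constant_scaleR add.commute)
  also have "x * (star x * ?R0 x) = form x x *\<^sub>R ?R0 x"
    by (rule left_mult_star_M [OF xM])
  \<comment> \<open>Replacing \<open>star x\<close> by \<open>2 * form x 1 - x\<close> makes the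
    products \<open>x * ?R1 x\<close> cancel.\<close>
  also have "star x * ?R1 x = (2 * form x 1) *\<^sub>R ?R1 x - x * ?R1 x"
    by (simp add: star_M [OF xM] alg.diff_left alg.scaleR_left mult_one_left)
  also have "(real m + 1) *\<^sub>R ?P x + l *\<^sub>R (form x x *\<^sub>R ?R0 x - ((2 * form x 1) *\<^sub>R ?R1 x - x * ?R1 x)) - l *\<^sub>R (x * ?R1 x - ?R2 x)
    = (real m + 1 + l) *\<^sub>R ?P x"
  proof -
    have ex: "?P x = ?R2 x - (2 * form x 1) *\<^sub>R ?R1 x + form x x *\<^sub>R ?R0 x"
      by (rule axial_dd_expand [OF hol x])
    have "l *\<^sub>R (form x x *\<^sub>R ?R0 x - ((2 * form x 1) *\<^sub>R ?R1 x - x * ?R1 x)) - l *\<^sub>R (x * ?R1 x - ?R2 x)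
      = l *\<^sub>R ?P x"
      unfolding ex by (simp add: algebra_simps)
    then show ?thesis
      by (simp add: scaleR_add_left)
  qed
  also have "real m + 1 + l = 0" by (simp add: m l_def)
  finally show ?thesis by simp
qed

lemma slice_comp_in_kernel:
  assumes m: "m = 2 * n + 3" and hol: "hol \<alpha>" "hol \<beta>"
  shows "in_kernel_dbar_laplace m v \<Omega> (slice_comp n \<alpha> \<beta>)"
  unfolding in_kernel_dbar_laplace_def
proof (intro conjI ballI)
  show "Ck_on 3 m v \<Omega> (slice_comp n \<alpha> \<beta>)"
    by (intro smooth_Ck_on smooth_slice_comp hol)
  fix x assume x: "x \<in> \<Omega>"
  have "dbar m v (laplace m v (slice_comp n \<alpha> \<beta>)) x = dbar m v (\<lambda>x. (4 * real (Suc n)) *\<^sub>R axial (Suc n) \<beta> x) x"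
    by (rule dbar_cong [OF _ x]) (rule laplace_slice_comp [OF m hol])
  then show "dbar m v (laplace m v (slice_comp n \<alpha> \<beta>)) x = 0"
    by (simp only: dbar_axial [OF m hol(2) x])
qed

lemma slice_comp_biharmonic:
  assumes m: "m = 2 * n + 3" and hol: "hol \<alpha>" "hol \<beta>"
  shows "biharmonic_on m v \<Omega> (slice_comp n \<alpha> \<beta>)"
  unfolding biharmonic_on_def
proof (intro conjI ballI)
  show "Ck_on 4 m v \<Omega> (slice_comp n \<alpha> \<beta>)"
    by (intro smooth_Ck_on smooth_slice_comp hol)
  fix x assume x: "x \<in> \<Omega>"
  have "laplace m v (laplace m v (slice_comp n \<alpha> \<beta>)) x = laplace m v (\<lambda>x. (4 * real (Suc n)) *\<^sub>R axial (Suc n) \<beta> x) x"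
    by (rule laplace_cong [OF _ x]) (rule laplace_slice_comp [OF m hol])
  then show "laplace m v (laplace m v (slice_comp n \<alpha> \<beta>)) x = 0"
    by (simp only: laplace_axial [OF m hol(2) x])
qed

end

section \<open>Stem functions and the decomposition\<close>

text \<open>A real functional applied to both components turns the complex structure on pairs into
  multiplication by \<open>\<i>\<close>, so the real derivative becomes complex linear.\<close>

lemma holomorphic_stem_coefficient:
  fixes F :: "complex \<Rightarrow> 'a \<times> 'a::alternative_star_algebra"
  assumes F: "holomorphic_stem D F" and D: "open D" and l: "bounded_linear (l :: 'a \<Rightarrow> real)"
  shows "(\<lambda>z. Complex (l (fst (F z))) (l (snd (F z)))) holomorphic_on D"
  unfolding holomorphic_on_open [OF D]
proof
  fix z assume "z \<in> D"
  then obtain F' where F': "(F has_derivative F') (at z)" "\<And>w. F' (\<i> * w) = (- snd (F' w), fst (F' w))"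
    using F by (auto simp: holomorphic_stem_def)
  let ?L = "\<lambda>p. Complex (l (fst p)) (l (snd p))"
  have L: "bounded_linear ?L"
  proof -
    have "bounded_linear (\<lambda>p::'a \<times> 'a. l (fst p) *\<^sub>R (1::complex) + l (snd p) *\<^sub>R \<i>)"
      by (intro bounded_linear_add bounded_linear_compose [OF bounded_linear_scaleR_left]
          bounded_linear_compose [OF l] bounded_linear_fst bounded_linear_snd)
    moreover have "?L = (\<lambda>p. l (fst p) *\<^sub>R (1::complex) + l (snd p) *\<^sub>R \<i>)"
      by (auto simp: complex_eq_iff)
    ultimately show ?thesis by simp
  qed
  have lneg: "l (- y) = - l y" for y
    using linear_neg [OF bounded_linear.linear [OF l]] .
  have d: "((\<lambda>z. ?L (F z)) has_derivative (\<lambda>w. ?L (F' w))) (at z)"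
    by (rule bounded_linear.has_derivative [OF L F'(1)])
  then have lin: "linear (\<lambda>w. ?L (F' w))"
    by (simp add: bounded_linear.linear has_derivative_bounded_linear)
  have "?L (F' w) = ?L (F' 1) * w" for w
  proof -
    have "w = Re w *\<^sub>R 1 + Im w *\<^sub>R (\<i> * 1)"
      by (simp add: complex_eq_iff)
    then have "?L (F' w) = Re w *\<^sub>R ?L (F' 1) + Im w *\<^sub>R ?L (F' (\<i> * 1))"
      by (metis linear_add [OF lin] linear_scale [OF lin])
    also have "?L (F' (\<i> * 1)) = \<i> * ?L (F' 1)"
      unfolding F'(2) by (simp add: complex_eq_iff lneg)
    finally show ?thesis by (simp add: complex_eq_iff)
  qed
  then have "((\<lambda>z. ?L (F z)) has_field_derivative ?L (F' 1)) (at z)"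
    unfolding has_field_derivative_def using d by (metis (no_types, lifting) ext)
  then show "\<exists>f'. ((\<lambda>z. ?L (F z)) has_field_derivative f') (at z)"
    by blast
qed

text \<open>The values on the slices of \<open>v 1\<close> and \<open>- v 1\<close> determine both
  components of the stem. Hence the holomorphic stem of a slice-preserving function is itself
  real.\<close>

lemma stem_unique:
  assumes "hypercomplex M m v" "1 \<le> m" "\<And>z. z \<in> D \<Longrightarrow> cnj z \<in> D"
    and "slice_with_stem D (circularization D \<inter> M) F f" "slice_with_stem D (circularization D \<inter> M) G f"
    and z: "z \<in> D"
  shows "F z = G z"
proof -
  interpret hypercomplex M m v by fact
  have J: "v 1 \<in> imag_units" "v 1 \<in> M"
    using v_imag_unit [of 1] v_M [of 1] \<open>1 \<le> m\<close> by simp_all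
  have f: "f (Re z *\<^sub>R 1 + Im z *\<^sub>R J) = fst H + J * snd H"
    if H: "slice_with_stem D (circularization D \<inter> M) K f" "H = K z" and J: "J \<in> imag_units" "J \<in> M" for J K H
  proof -
    have "Re z *\<^sub>R 1 + Im z *\<^sub>R J \<in> circularization D \<inter> M"
      using J z subspace_M one_in_M by (auto simp: circularization_def intro: subspace_add subspace_scale)
    then show ?thesis using H J z unfolding slice_with_stem_def induces_def by auto
  qed
  have J': "- v 1 \<in> imag_units" "- v 1 \<in> M"
    using J minus_imag_units subspace_M by (auto intro: subspace_neg)
  have 1: "fst (F z) + v 1 * snd (F z) = fst (G z) + v 1 * snd (G z)"
    using f [OF assms(4) refl J] f [OF assms(5) refl J] by simp
  have 2: "fst (F z) - v 1 * snd (F z) = fst (G z) - v 1 * snd (G z)"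
    using f [OF assms(4) refl J'] f [OF assms(5) refl J'] by (simp add: alg.minus_left)
  have "2 *\<^sub>R fst (F z) = (fst (F z) + v 1 * snd (F z)) + (fst (F z) - v 1 * snd (F z))"
    by (simp add: scaleR_2)
  also have "\<dots> = 2 *\<^sub>R fst (G z)"
    unfolding 1 2 by (simp add: scaleR_2)
  finally have fst: "fst (F z) = fst (G z)" by simp
  then have "v 1 * snd (F z) = v 1 * snd (G z)" using 1 by simp
  then have "v 1 * (v 1 * snd (F z)) = v 1 * (v 1 * snd (G z))" by simp
  then have "snd (F z) = snd (G z)" by (simp only: imag_units_left_mult_mult [OF J(1)] neg_equal_iff_equal)
  with fst show ?thesis by (simp add: prod_eq_iff)
qed

text \<open>The weights are induced by the real functions \<open>|z| ^ (2 * k)\<close>, which are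
  invariant under conjugation, so multiplying stems by them keeps the stem symmetry and real
  values.\<close>

lemma slice_preserving_sum:
  fixes M :: "'a::alternative_star_algebra set"
  assumes "hypercomplex M m v" "\<And>z. z \<in> D \<Longrightarrow> cnj z \<in> D" "\<Omega> = circularization D \<inter> M"
    and g: "\<And>k. k \<le> n \<Longrightarrow> slice_preserving_on D \<Omega> (g k)"
    and f: "\<And>x. x \<in> \<Omega> \<Longrightarrow> f x = (\<Sum>k\<le>n. hc_norm x ^ (2 * k) *\<^sub>R g k x)"
  shows "slice_preserving_on D \<Omega> f"
proof -
  interpret hypercomplex M m v by fact
  obtain G h where G: "\<And>k. k \<le> n \<Longrightarrow> stem_function D (G k)" "\<And>k. k \<le> n \<Longrightarrow> real_stem D (G k)"
    "\<And>k. k \<le> n \<Longrightarrow> induces D (G k) (h k)" "\<And>k x. k \<le> n \<Longrightarrow> x \<in> \<Omega> \<Longrightarrow> g k x = h k x"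
    using g unfolding slice_preserving_on_def slice_with_stem_def by metis
  define F where "F z = ((\<Sum>k\<le>n. cmod z ^ (2 * k) *\<^sub>R fst (G k z)), (\<Sum>k\<le>n. cmod z ^ (2 * k) *\<^sub>R snd (G k z)))" for z
  \<comment> \<open>The weight \<open>cmod (slice_coord x)\<close> extends the sum to the whole
    circularization and agrees with \<open>hc_norm\<close> on \<open>M\<close>.\<close>
  define f' where "f' x = (\<Sum>k\<le>n. cmod (slice_coord x) ^ (2 * k) *\<^sub>R h k x)" for x
  have "stem_function D F"
    using G(1) unfolding stem_function_def F_def by (auto simp: sum_negf [symmetric])
  moreover have "real_stem D F"
    using G(2) unfolding real_stem_def F_def by (auto intro!: span_sum span_scale)
  moreover have "induces D F f'"
    unfolding induces_def
  proof (intro ballI)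
    fix z J assume z: "z \<in> D" and J: "J \<in> (imag_units :: 'a set)"
    have c: "cmod (slice_coord (Re z *\<^sub>R 1 + Im z *\<^sub>R J)) = cmod z"
      using slice_coord_cases [OF J, of z] by auto
    have "f' (Re z *\<^sub>R 1 + Im z *\<^sub>R J) = (\<Sum>k\<le>n. cmod z ^ (2 * k) *\<^sub>R (fst (G k z) + J * snd (G k z)))"
      unfolding f'_def c using G(3) z J unfolding induces_def by (intro sum.cong) auto
    also have "\<dots> = fst (F z) + J * snd (F z)"
      by (simp add: F_def scaleR_add_right sum.distrib alg.sum_right alg.scaleR_right)
    finally show "f' (Re z *\<^sub>R 1 + Im z *\<^sub>R J) = fst (F z) + J * snd (F z)" .
  qed
  moreover have "f x = f' x" if "x \<in> \<Omega>" for x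
    using that assms(3) G(4) by (simp add: f f'_def hc_norm_M)
  ultimately show ?thesis
    unfolding slice_preserving_on_def slice_with_stem_def by blast
qed

section \<open>Stems of the components and expansion of the given function\<close>

context axial_domain
begin

text \<open>On a slice \<open>star x = Re z - Im z J\<close>. Invariance of \<open>dd\<close> under
  conjugation makes the first component even and the second odd.\<close>

lemma slice_with_stem_slice_comp:
  "slice_with_stem D \<Omega> (\<lambda>z. (slice_dd q \<alpha> z - Re z *\<^sub>R slice_dd q \<beta> z, Im z *\<^sub>R slice_dd q \<beta> z)) (slice_comp q \<alpha> \<beta>)"
  unfolding slice_with_stem_def
proof (intro conjI exI)
  let ?F = "\<lambda>z. (slice_dd q \<alpha> z - Re z *\<^sub>R slice_dd q \<beta> z, Im z *\<^sub>R slice_dd q \<beta> z)"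
  show "stem_function D ?F"
    by (simp add: stem_function_def slice_dd_cnj)
  show "induces D ?F (slice_comp q \<alpha> \<beta>)"
    unfolding induces_def
  proof (intro ballI)
    fix z and J :: 'a assume J: "J \<in> imag_units"
    let ?x = "Re z *\<^sub>R 1 + Im z *\<^sub>R J"
    have "axial_dd q \<psi> ?x = slice_dd q \<psi> z" for \<psi>
      using slice_coord_cases [OF J, of z] by (auto simp: axial_dd_def slice_dd_cnj)
    then show "slice_comp q \<alpha> \<beta> ?x = fst (?F z) + J * snd (?F z)"
      by (simp add: slice_comp_def complex_slice(1) [OF J refl] alg.diff_left alg.scaleR_left alg.scaleR_right mult_one_left)
  qed
qed simp

lemma slice_on_slice_comp: "slice_on D \<Omega> (slice_comp q \<alpha> \<beta>)"
  using slice_with_stem_slice_comp unfolding slice_on_def by blast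

lemma slice_preserving_on_slice_comp:
  assumes "E = {1}"
  shows "slice_preserving_on D \<Omega> (slice_comp q \<alpha> \<beta>)"
proof -
  have "slice_dd q \<psi> z \<in> span {1}" for \<psi> z
    unfolding slice_dd_def using assms by (simp add: span_base span_scale)
  then have "real_stem D (\<lambda>z. (slice_dd q \<alpha> z - Re z *\<^sub>R slice_dd q \<beta> z, Im z *\<^sub>R slice_dd q \<beta> z))"
    by (auto simp: real_stem_def intro: span_diff span_scale)
  then show ?thesis
    using slice_with_stem_slice_comp unfolding slice_preserving_on_def by blast
qed

text \<open>Coefficientwise, \<open>dd_0_Re_Im\<close> identifies the two stems on
  \<open>D\<close>.\<close>

lemma slice_eq_slice_comp:
  assumes F: "slice_with_stem D \<Omega> F f" and hol: "hol \<phi>"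
    and sym: "\<And>e z. e \<in> E \<Longrightarrow> z \<in> D \<Longrightarrow> \<phi> e (cnj z) = cnj (\<phi> e z)"
    and repr: "\<And>z. z \<in> D \<Longrightarrow> fst (F z) = (\<Sum>e\<in>E. Re (\<phi> e z) *\<^sub>R e)"
      "\<And>z. z \<in> D \<Longrightarrow> snd (F z) = (\<Sum>e\<in>E. Im (\<phi> e z) *\<^sub>R e)"
    and x: "x \<in> \<Omega>"
  shows "f x = slice_comp 0 (times_id \<phi>) \<phi> x"
proof -
  let ?F = "\<lambda>z. (slice_dd 0 (times_id \<phi>) z - Re z *\<^sub>R slice_dd 0 \<phi> z, Im z *\<^sub>R slice_dd 0 \<phi> z)"
  have eq: "F z = ?F z" if z: "z \<in> D" for z
  proof -
    have *: "Re (\<phi> e z) = Re (dd 0 (times_id \<phi> e) z) - Re z * Re (dd 0 (\<phi> e) z)"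
      "Im (\<phi> e z) = Im z * Re (dd 0 (\<phi> e) z)" if "e \<in> E" for e
      using dd_0_Re_Im [of "\<phi> e" z] hol sym z that by (simp_all add: hol_def times_id_def [abs_def])
    have "fst (F z) = slice_dd 0 (times_id \<phi>) z - Re z *\<^sub>R slice_dd 0 \<phi> z"
      unfolding repr(1) [OF z] slice_dd_def scaleR_sum_right sum_subtractf [symmetric]
      by (intro sum.cong refl) (simp add: *(1) algebra_simps)
    moreover have "snd (F z) = Im z *\<^sub>R slice_dd 0 \<phi> z"
      unfolding repr(2) [OF z] slice_dd_def scaleR_sum_right
      by (intro sum.cong refl) (simp add: *(2))
    ultimately show ?thesis by (simp add: prod_eq_iff)
  qed
  obtain z J where zJ: "z \<in> D" "J \<in> imag_units" "x = Re z *\<^sub>R 1 + Im z *\<^sub>R J"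
    using x by (auto simp: Omega circularization_def)
  have "f x = fst (F z) + J * snd (F z)"
    using F x zJ by (auto simp: slice_with_stem_def induces_def)
  moreover have "slice_comp 0 (times_id \<phi>) \<phi> x = fst (?F z) + J * snd (?F z)"
    using slice_with_stem_slice_comp [of 0 "times_id \<phi>" \<phi>] x zJ by (auto simp: slice_with_stem_def induces_def)
  ultimately show ?thesis by (simp only: eq [OF zJ(1)])
qed

lemma slice_comp_0_expansion:
  assumes star: "star_cnj_domain D" and hol: "hol \<phi>"
  obtains \<alpha> \<beta> where "\<And>k. hol (\<alpha> k)" "\<And>k. hol (\<beta> k)"
    "\<And>x. x \<in> \<Omega> \<Longrightarrow> slice_comp 0 (times_id \<phi>) \<phi> x = (\<Sum>k\<le>n. hc_norm x ^ (2 * k) *\<^sub>R slice_comp n (\<alpha> k) (\<beta> k) x)"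
proof -
  have ex: "\<exists>\<gamma>. (\<forall>k. hol (\<gamma> k)) \<and>
      (\<forall>x\<in>\<Omega>. axial_dd 0 \<psi> x = (\<Sum>k\<le>n. hc_norm x ^ (2 * k) *\<^sub>R axial_dd n (\<gamma> k) x))" if "hol \<psi>" for \<psi>
  proof -
    have "\<forall>e\<in>E. \<exists>\<gamma>. (\<forall>k. \<gamma> k holomorphic_on D) \<and>
      (\<forall>z\<in>D. dd 0 (\<psi> e) z = (\<Sum>k\<le>n. of_real (cmod z ^ (2 * k)) * dd n (\<gamma> k) z))"
      using star_cnj_domain.dd_0_expansion [OF star] that unfolding hol_def by blast
    from bchoice [OF this] obtain \<gamma> where \<gamma>: "\<And>e k. e \<in> E \<Longrightarrow> \<gamma> e k holomorphic_on D"
      "\<And>e z. e \<in> E \<Longrightarrow> z \<in> D \<Longrightarrow> dd 0 (\<psi> e) z = (\<Sum>k\<le>n. of_real (cmod z ^ (2 * k)) * dd n (\<gamma> e k) z)"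
      by blast
    have "axial_dd 0 \<psi> x = (\<Sum>k\<le>n. hc_norm x ^ (2 * k) *\<^sub>R axial_dd n (\<lambda>e. \<gamma> e k) x)" if "x \<in> \<Omega>" for x
    proof -
      let ?z = "slice_coord x"
      have z: "?z \<in> D" and c: "hc_norm x = cmod ?z"
        using that by (auto simp: Omega_iff hc_norm_M)
      have "axial_dd 0 \<psi> x = (\<Sum>e\<in>E. \<Sum>k\<le>n. cmod ?z ^ (2 * k) *\<^sub>R (Re (dd n (\<gamma> e k) ?z) *\<^sub>R e))"
        unfolding axial_dd_def slice_dd_def
        by (intro sum.cong refl) (simp add: \<gamma>(2) z Re_sum scaleR_sum_left flip: of_real_power)
      also have "\<dots> = (\<Sum>k\<le>n. \<Sum>e\<in>E. cmod ?z ^ (2 * k) *\<^sub>R (Re (dd n (\<gamma> e k) ?z) *\<^sub>R e))"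
        by (rule sum.swap)
      finally show ?thesis
        by (simp only: axial_dd_def slice_dd_def scaleR_sum_right c)
    qed
    then show ?thesis
      using \<gamma>(1) by (intro exI [of _ "\<lambda>k e. \<gamma> e k"]) (simp add: hol_def)
  qed
  from ex [OF hol_times_id [OF hol]] obtain \<alpha> where \<alpha>: "\<And>k. hol (\<alpha> k)"
    "\<And>x. x \<in> \<Omega> \<Longrightarrow> axial_dd 0 (times_id \<phi>) x = (\<Sum>k\<le>n. hc_norm x ^ (2 * k) *\<^sub>R axial_dd n (\<alpha> k) x)" by blast
  from ex [OF hol] obtain \<beta> where \<beta>: "\<And>k. hol (\<beta> k)"
    "\<And>x. x \<in> \<Omega> \<Longrightarrow> axial_dd 0 \<phi> x = (\<Sum>k\<le>n. hc_norm x ^ (2 * k) *\<^sub>R axial_dd n (\<beta> k) x)" by blast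
  show ?thesis
  proof (rule that [OF \<alpha>(1) \<beta>(1)])
    fix x assume "x \<in> \<Omega>"
    then show "slice_comp 0 (times_id \<phi>) \<phi> x = (\<Sum>k\<le>n. hc_norm x ^ (2 * k) *\<^sub>R slice_comp n (\<alpha> k) (\<beta> k) x)"
      by (simp add: slice_comp_def \<alpha>(2) \<beta>(2) alg.sum_right alg.scaleR_right scaleR_diff_right sum_subtractf)
  qed
qed

end

text \<open>The slice through \<open>v 1\<close> contains a copy of \<open>D\<close> inside
  \<open>\<Omega>\<close>, so the star shape passes to \<open>D\<close>.\<close>

lemma star_cnj_domain_profile:
  assumes "hypercomplex M m v" "1 \<le> m" and D: "open D" "\<forall>z\<in>D. cnj z \<in> D"
    and \<Omega>: "\<Omega> = circularization D \<inter> M" "0 \<in> \<Omega>" "\<forall>x\<in>\<Omega>. closed_segment 0 x \<subseteq> \<Omega>"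
  shows "star_cnj_domain D"
proof -
  interpret hypercomplex M m v by fact
  have cnj: "z \<in> D \<Longrightarrow> cnj z \<in> D" for z using D by blast
  have J: "v 1 \<in> imag_units" "v 1 \<in> M"
    using v_imag_unit [of 1] v_M [of 1] \<open>1 \<le> m\<close> by simp_all
  have slice: "Re z *\<^sub>R 1 + Im z *\<^sub>R v 1 \<in> \<Omega> \<longleftrightarrow> z \<in> D" for z
  proof -
    have "Re z *\<^sub>R 1 + Im z *\<^sub>R v 1 \<in> M"
      using J subspace_M one_in_M by (auto intro: subspace_add subspace_scale)
    then show ?thesis
      using mem_circularization_iff [OF _ cnj] slice_coord_cases [OF J(1), of z] cnj [of z] cnj [of "cnj z"]
      by (auto simp: \<Omega>(1))
  qed
  show ?thesis
  proof
    show "0 \<in> D" using slice [of 0] \<Omega>(2) by simp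
    show "closed_segment 0 z \<subseteq> D" if "z \<in> D" for z
    proof
      fix w assume "w \<in> closed_segment 0 z"
      then obtain t where t: "0 \<le> t" "t \<le> 1" "w = t *\<^sub>R z" by (auto simp: in_segment)
      let ?x = "Re z *\<^sub>R 1 + Im z *\<^sub>R v 1"
      have "t *\<^sub>R ?x \<in> closed_segment 0 ?x" using t by (auto simp: in_segment)
      then have "t *\<^sub>R ?x \<in> \<Omega>" using \<Omega>(3) slice that by blast
      then show "w \<in> D" using slice [of w] t by (simp add: scaleR_add_right)
    qed
  qed (use D in auto)
qed

text \<open>The functionals \<open>l e\<close> have to reproduce the values of \<open>F\<close>
  only. This admits \<open>Basis\<close> for general stems and \<open>{1}\<close> for real ones, the
  latter giving real component stems.\<close>

lemma slice_regular_decomposition: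
  fixes M \<Omega> E :: "'a::alternative_star_algebra set"
  assumes hyp: "hypercomplex M m v" and star: "star_cnj_domain D" and \<Omega>: "\<Omega> = circularization D \<inter> M"
    and m: "m = 2 * n + 3" and F: "slice_with_stem D \<Omega> F f" "holomorphic_stem D F"
    and E: "finite E" and l: "\<And>e. bounded_linear (l e :: 'a \<Rightarrow> real)"
    and repr: "\<And>z. z \<in> D \<Longrightarrow> fst (F z) = (\<Sum>e\<in>E. l e (fst (F z)) *\<^sub>R e)"
      "\<And>z. z \<in> D \<Longrightarrow> snd (F z) = (\<Sum>e\<in>E. l e (snd (F z)) *\<^sub>R e)"
  shows "\<exists>g. (\<forall>k. slice_on D \<Omega> (g k) \<and> in_kernel_dbar_laplace m v \<Omega> (g k) \<and> biharmonic_on m v \<Omega> (g k) \<and>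
      (E = {1} \<longrightarrow> slice_preserving_on D \<Omega> (g k))) \<and>
    (\<forall>x\<in>\<Omega>. f x = (\<Sum>k\<le>n. hc_norm x ^ (2 * k) *\<^sub>R g k x))"
proof -
  interpret star_cnj_domain D by (rule star)
  interpret axial_domain M m v D \<Omega> E
    by (intro axial_domain.intro hyp cnj_domain_axioms axial_domain_axioms.intro \<Omega> E)
  define \<phi> where "\<phi> e z = Complex (l e (fst (F z))) (l e (snd (F z)))" for e z
  have "hol \<phi>"
    unfolding hol_def \<phi>_def using holomorphic_stem_coefficient [OF F(2) open_D l] by blast
  then obtain \<alpha> \<beta> where \<alpha>\<beta>: "\<And>k. hol (\<alpha> k)" "\<And>k. hol (\<beta> k)"
    "\<And>x. x \<in> \<Omega> \<Longrightarrow> slice_comp 0 (times_id \<phi>) \<phi> x = (\<Sum>k\<le>n. hc_norm x ^ (2 * k) *\<^sub>R slice_comp n (\<alpha> k) (\<beta> k) x)"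
    using slice_comp_0_expansion [OF star, of \<phi> n] by blast
  have sym: "\<phi> e (cnj z) = cnj (\<phi> e z)" if "z \<in> D" for e z
    using F(1) that linear_neg [OF bounded_linear.linear [OF l]]
    by (simp add: \<phi>_def slice_with_stem_def stem_function_def complex_eq_iff)
  have "f x = slice_comp 0 (times_id \<phi>) \<phi> x" if "x \<in> \<Omega>" for x
    by (rule slice_eq_slice_comp [OF F(1) \<open>hol \<phi>\<close> sym _ _ that]) (use repr in \<open>simp_all add: \<phi>_def\<close>)
  then have "\<forall>x\<in>\<Omega>. f x = (\<Sum>k\<le>n. hc_norm x ^ (2 * k) *\<^sub>R slice_comp n (\<alpha> k) (\<beta> k) x)"
    by (simp add: \<alpha>\<beta>(3))
  moreover have "slice_on D \<Omega> (slice_comp n (\<alpha> k) (\<beta> k)) \<and> in_kernel_dbar_laplace m v \<Omega> (slice_comp n (\<alpha> k) (\<beta> k)) \<and>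
      biharmonic_on m v \<Omega> (slice_comp n (\<alpha> k) (\<beta> k)) \<and> (E = {1} \<longrightarrow> slice_preserving_on D \<Omega> (slice_comp n (\<alpha> k) (\<beta> k)))" for k
    by (intro conjI impI slice_on_slice_comp slice_comp_in_kernel [OF m \<alpha>\<beta>(1,2)] slice_comp_biharmonic [OF m \<alpha>\<beta>(1,2)]
        slice_preserving_on_slice_comp)
  ultimately show ?thesis
    by (intro exI [of _ "\<lambda>k. slice_comp n (\<alpha> k) (\<beta> k)"] conjI allI) simp_all
qed

theorem theorem30:
  fixes M \<Omega> :: "'a::alternative_star_algebra set"
    and m :: nat
    and v :: "nat \<Rightarrow> 'a"
    and D :: "complex set"
    and f :: "'a \<Rightarrow> 'a"
  assumes "(imag_units :: 'a set) \<noteq> {}"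
    and "hypercomplex_subspace M"
    and "m = dim M - 1" and "m \<ge> 3" and "odd m"
    and "orthonormal_basis M m v"
    and "open D" and "\<forall>z\<in>D. cnj z \<in> D"
    and "\<Omega> = circularization D \<inter> M"
    and "0 \<in> \<Omega>" and "\<forall>x\<in>\<Omega>. closed_segment 0 x \<subseteq> \<Omega>"
    and "slice_regular_on D \<Omega> f"
    and "(\<exists>x y z :: 'a. associator x y z \<noteq> 0) \<longrightarrow>
           admissible M m v \<Omega> f \<and> admissible M m v \<Omega> (\<lambda>x. x * f x)"
  shows "\<exists>g :: nat \<Rightarrow> 'a \<Rightarrow> 'a.
     (\<forall>k \<le> (m - 3) div 2. slice_on D \<Omega> (g k) \<and> in_kernel_dbar_laplace m v \<Omega> (g k)) \<and>
     (\<forall>x\<in>\<Omega>. f x = (\<Sum>k = 0..(m - 3) div 2. hc_norm x ^ (2 * k) *\<^sub>R g k x)) \<and>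
     (\<forall>k \<le> (m - 3) div 2. biharmonic_on m v \<Omega> (g k)) \<and>
     (slice_preserving_on D \<Omega> f \<longleftrightarrow> (\<forall>k \<le> (m - 3) div 2. slice_preserving_on D \<Omega> (g k)))"
proof -
  define n where "n = (m - 3) div 2"
  have m: "m = 2 * n + 3"
    using \<open>odd m\<close> \<open>m \<ge> 3\<close> unfolding n_def by presburger
  have hyp: "hypercomplex M m v"
    using assms(2,6) by unfold_locales
  have star: "star_cnj_domain D"
    using star_cnj_domain_profile [OF hyp _ assms(7-11)] \<open>m \<ge> 3\<close> by simp
  have cnj: "\<And>z. z \<in> D \<Longrightarrow> cnj z \<in> D" using assms(8) by blast
  obtain F where F: "slice_with_stem D \<Omega> F f" "holomorphic_stem D F"
    using assms(12) by (auto simp: slice_regular_on_def)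
  let ?P = "\<lambda>g. (\<forall>k. slice_on D \<Omega> (g k) \<and> in_kernel_dbar_laplace m v \<Omega> (g k) \<and> biharmonic_on m v \<Omega> (g k)) \<and>
      (\<forall>x\<in>\<Omega>. f x = (\<Sum>k\<le>n. hc_norm x ^ (2 * k) *\<^sub>R g k x))"
  \<comment> \<open>The choice of \<open>E\<close> decides whether the components have real stems,
    hence the case distinction before \<open>g\<close> is fixed.\<close>
  have "\<exists>g. ?P g \<and> (slice_preserving_on D \<Omega> f \<longrightarrow> (\<forall>k. slice_preserving_on D \<Omega> (g k)))"
  proof (cases "slice_preserving_on D \<Omega> f")
    case True
    \<comment> \<open>Then \<open>F\<close> is real-valued, and it is decomposed with respect to \<open>E = {1}\<close> to keep real stems.\<close>
    then obtain G where G: "slice_with_stem D \<Omega> G f" "real_stem D G"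
      by (auto simp: slice_preserving_on_def)
    have "F z = G z" if "z \<in> D" for z
      using stem_unique [OF hyp _ cnj _ _ that, of F f G] F(1) G(1) assms(9) \<open>m \<ge> 3\<close> by simp
    then have "fst (F z) \<in> span {1}" "snd (F z) \<in> span {1}" if "z \<in> D" for z
      using G(2) that by (auto simp: real_stem_def)
    then have repr: "fst (F z) = (\<Sum>e\<in>{1}. scalar_part (fst (F z)) *\<^sub>R e)"
      "snd (F z) = (\<Sum>e\<in>{1}. scalar_part (snd (F z)) *\<^sub>R e)" if "z \<in> D" for z
      using that by (simp_all add: scaleR_scalar_part)
    have "\<exists>g. (\<forall>k. slice_on D \<Omega> (g k) \<and> in_kernel_dbar_laplace m v \<Omega> (g k) \<and> biharmonic_on m v \<Omega> (g k) \<and>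
        ({1 :: 'a} = {1} \<longrightarrow> slice_preserving_on D \<Omega> (g k))) \<and>
      (\<forall>x\<in>\<Omega>. f x = (\<Sum>k\<le>n. hc_norm x ^ (2 * k) *\<^sub>R g k x))"
      by (rule slice_regular_decomposition [OF hyp star assms(9) m F, where l = "\<lambda>_. scalar_part"])
        (simp, rule bounded_linear_scalar_part, erule repr(1), erule repr(2))
    then show ?thesis by blast
  next
    case False
    have "fst (F z) = (\<Sum>e\<in>Basis. inner (fst (F z)) e *\<^sub>R e)"
      "snd (F z) = (\<Sum>e\<in>Basis. inner (snd (F z)) e *\<^sub>R e)" for z
      by (simp_all add: euclidean_representation)
    \<comment> \<open>The implication about slice-preserving components is vacuous in this
      case.\<close>
    from slice_regular_decomposition [OF hyp star assms(9) m F finite_Basis bounded_linear_inner_left this] False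
    show ?thesis by (elim exE) blast
  qed
  then obtain g where g: "\<forall>k. slice_on D \<Omega> (g k) \<and> in_kernel_dbar_laplace m v \<Omega> (g k) \<and> biharmonic_on m v \<Omega> (g k)"
    "\<forall>x\<in>\<Omega>. f x = (\<Sum>k\<le>n. hc_norm x ^ (2 * k) *\<^sub>R g k x)"
    "slice_preserving_on D \<Omega> f \<longrightarrow> (\<forall>k. slice_preserving_on D \<Omega> (g k))"
    by (elim exE conjE)
  \<comment> \<open>The converse direction follows from the decomposition formula alone.\<close>
  have "slice_preserving_on D \<Omega> f" if "\<forall>k\<le>n. slice_preserving_on D \<Omega> (g k)"
    by (rule slice_preserving_sum [OF hyp cnj assms(9)]) (use that g(2) in simp_all)
  with g show ?thesis
    unfolding n_def [symmetric] atMost_atLeast0 [symmetric] by (intro exI [of _ g] conjI) (simp, simp, simp, blast)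
qed

end
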